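(* Let $\mathbb F$ be an algebraically closed field of characteristic zero. Let $L:\mathbb F^n\to\mathbb F^m$ and $M:\mathbb F^r\to\mathbb F^m$ be polynomial maps with $\mathrm{im}(L)\subseteq\mathrm{im}(M)$. Let $\mathbf z=(z_1,\dots,z_n)$ be indeterminates. Then there exist $\mathbf c\in\mathbb F^n$ and formal power series $p_1(\mathbf z),\dots,p_r(\mathbf z)\in\mathbb F[[z_1,\dots,z_n]]$ such that $$L(\mathbf z+\mathbf c)=M(p_1(\mathbf z),\dots,p_r(\mathbf z))$$ as an equality in $\mathbb F[[z_1,\dots,z_n]]^m$.
   Context: A polynomial map $L=(L_1,\dots,L_m):\mathbb F^n\to\mathbb F^m$ is one whose components are polynomial functions. $\mathbb F[[z_1,\dots,z_n]]$ denotes the ring of formal power series around $\mathbf 0$; equality is coefficientwise. *)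

theory Defs
  imports "HOL-Computational_Algebra.Polynomial"
begin

text \<open>Exponent vectors (multi-indices) are functions nat => nat.
  Monomials in the variables z_0,...,z_{n-1} have exponents in exps n.\<close>

definition exps :: "nat \<Rightarrow> (nat \<Rightarrow> nat) set" where
  "exps n = {\<alpha>. \<forall>i\<ge>n. \<alpha> i = 0}"

definition is_mpoly :: "nat \<Rightarrow> ((nat \<Rightarrow> nat) \<Rightarrow> 'a::zero) \<Rightarrow> bool" where
  "is_mpoly n P \<longleftrightarrow> finite {\<alpha>. P \<alpha> \<noteq> 0} \<and> {\<alpha>. P \<alpha> \<noteq> 0} \<subseteq> exps n"

definition peval :: "nat \<Rightarrow> ((nat \<Rightarrow> nat) \<Rightarrow> 'a::comm_ring_1) \<Rightarrow> (nat \<Rightarrow> 'a) \<Rightarrow> 'a" where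
  "peval n P x = (\<Sum>\<alpha>\<in>{\<alpha>. P \<alpha> \<noteq> 0}. P \<alpha> * (\<Prod>i<n. x i ^ \<alpha> i))"

text \<open>Formal power series in the variables z_0, z_1, ..., represented by their
  coefficient functions on multi-indices; equality in F[[z_0..z_{n-1}]] is
  equality of the coefficients at multi-indices in exps n.\<close>

type_synonym 'a mps = "(nat \<Rightarrow> nat) \<Rightarrow> 'a"

definition mps_zero_exp :: "nat \<Rightarrow> nat" where
  "mps_zero_exp = (\<lambda>_. 0)"

definition mps_const :: "'a::zero \<Rightarrow> 'a mps" where
  "mps_const a = (\<lambda>\<alpha>. if \<alpha> = mps_zero_exp then a else 0)"

definition mps_one :: "'a::{zero,one} mps" where
  "mps_one = mps_const 1"

definition mps_var :: "nat \<Rightarrow> 'a::{zero,one} mps" where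
  "mps_var i = (\<lambda>\<alpha>. if \<alpha> = (\<lambda>j. if j = i then 1 else 0) then 1 else 0)"

definition mps_add :: "'a::plus mps \<Rightarrow> 'a mps \<Rightarrow> 'a mps" where
  "mps_add f g = (\<lambda>\<alpha>. f \<alpha> + g \<alpha>)"

text \<open>Cauchy product (the index set is finite for every multi-index with finite support).\<close>

definition mps_mult :: "'a::comm_ring_1 mps \<Rightarrow> 'a mps \<Rightarrow> 'a mps" where
  "mps_mult f g = (\<lambda>\<alpha>. \<Sum>\<beta>\<in>{\<beta>. \<forall>i. \<beta> i \<le> \<alpha> i}. f \<beta> * g (\<lambda>i. \<alpha> i - \<beta> i))"

definition mps_pow :: "'a::comm_ring_1 mps \<Rightarrow> nat \<Rightarrow> 'a mps" where
  "mps_pow f k = ((mps_mult f) ^^ k) mps_one"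

definition mps_monom :: "nat \<Rightarrow> (nat \<Rightarrow> nat) \<Rightarrow> (nat \<Rightarrow> 'a::comm_ring_1 mps) \<Rightarrow> 'a mps" where
  "mps_monom r \<alpha> p = foldr (\<lambda>i acc. mps_mult (mps_pow (p i) (\<alpha> i)) acc) [0..<r] mps_one"

definition mps_peval :: "nat \<Rightarrow> ((nat \<Rightarrow> nat) \<Rightarrow> 'a::comm_ring_1) \<Rightarrow> (nat \<Rightarrow> 'a mps) \<Rightarrow> 'a mps" where
  "mps_peval r P p = (\<lambda>\<beta>. \<Sum>\<alpha>\<in>{\<alpha>. P \<alpha> \<noteq> 0}. P \<alpha> * mps_monom r \<alpha> p \<beta>)"

end

theory Submission
  imports Defs "HOL-Library.Poly_Mapping" "HOL-Library.FuncSet"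
begin

text \<open>
  Choosing a preimage under \<open>M\<close> of every value of \<open>L\<close> gives a function \<open>Y\<close> with
  \<open>L x = M (Y x)\<close>. Modulo an ultrafilter on the points that contains the non-vanishing set of every
  nonzero polynomial, functions form a domain \<open>\<Omega>\<close> over the field; in it the coordinates
  \<open>z\<^sub>i\<close> are algebraically independent and the classes \<open>y\<^sub>j\<close> of the components of \<open>Y\<close> satisfy
  \<open>L(z) = M(y)\<close>. It remains to map the ring generated by the \<open>z\<^sub>i\<close> and \<open>y\<^sub>j\<close> to power series with
  \<open>z\<^sub>i \<mapsto> c\<^sub>i + X\<^sub>i\<close>. This is done one generator at a time, while keeping the constant term of the
  image of a prescribed nonzero element nonzero: a transcendental generator is sent to a generic
  constant (plus \<open>X\<^sub>i\<close>), and an algebraic one to a Hensel lift of a root of its minimal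
  polynomial, which stays separable when a Bezout constant of the polynomial and its derivative has
  nonzero constant term. Neither the Nullstellensatz nor a primitive element is needed.
\<close>

section \<open>Multivariate power series\<close>

text \<open>Finitely supported exponents make every Cauchy product a finite sum, so this type is a
  commutative ring. On all of \<open>nat \<Rightarrow> nat\<close> the index set in
  \<open>mps_mult\<close> can be infinite.\<close>

typedef 'a mfps = "UNIV :: ((nat \<Rightarrow>\<^sub>0 nat) \<Rightarrow> 'a) set"
  morphisms mfps_coeff Abs_mfps ..

setup_lifting type_definition_mfps

lemma mfps_eqI: "(\<And>\<beta>. mfps_coeff f \<beta> = mfps_coeff g \<beta>) \<Longrightarrow> f = g"
  by transfer auto

definition splits :: "(nat \<Rightarrow>\<^sub>0 nat) \<Rightarrow> ((nat \<Rightarrow>\<^sub>0 nat) \<times> (nat \<Rightarrow>\<^sub>0 nat)) set" where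
  "splits \<alpha> = {(\<beta>, \<gamma>). \<beta> + \<gamma> = \<alpha>}"

lemma finite_le_finite_support:
  fixes f :: "nat \<Rightarrow> nat"
  assumes "finite {i. f i \<noteq> 0}"
  shows "finite {g. \<forall>i. g i \<le> f i}"
proof (rule finite_subset)
  let ?A = "{i. f i \<noteq> 0}"
  show "{g. \<forall>i. g i \<le> f i} \<subseteq>
    {g. \<forall>i. (i \<in> ?A \<longrightarrow> g i \<in> {..Max (f ` ?A)}) \<and> (i \<notin> ?A \<longrightarrow> g i = 0)}"
  proof (intro subsetI CollectI allI conjI impI)
    fix g i assume "g \<in> {g. \<forall>i. g i \<le> f i}"
    then have le: "g i \<le> f i" by simp
    then show "g i = 0" if "i \<notin> ?A"
      using that by simp
    show "g i \<in> {..Max (f ` ?A)}" if "i \<in> ?A"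
    proof -
      have "f i \<le> Max (f ` ?A)" using assms that by (intro Max_ge) auto
      with le show ?thesis by simp
    qed
  qed
  show "finite {g. \<forall>i. (i \<in> ?A \<longrightarrow> g i \<in> {..Max (f ` ?A)}) \<and> (i \<notin> ?A \<longrightarrow> g i = 0)}"
    using assms by (intro finite_set_of_finite_funs) auto
qed

lemma finite_support_le:
  fixes f g :: "nat \<Rightarrow> nat"
  assumes "finite {i. f i \<noteq> 0}" "\<And>i. g i \<le> f i"
  shows "finite {i. g i \<noteq> 0}"
proof (rule finite_subset)
  show "{i. g i \<noteq> 0} \<subseteq> {i. f i \<noteq> 0}"
  proof (rule Collect_mono, rule impI)
    show "f i \<noteq> 0" if "g i \<noteq> 0" for i
      using assms(2)[of i] that by simp
  qed
qed (rule assms(1))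

text \<open>A pair with sum \<alpha> is determined by its first entry, which can be anything below
  \<alpha>. This gives finiteness of \<open>splits\<close> and later matches the index set of
  \<open>mps_mult\<close> with that of the ring product.\<close>

lemma bij_betw_splits:
  "bij_betw (\<lambda>p. Poly_Mapping.lookup (fst p)) (splits \<alpha>) {b. \<forall>i. b i \<le> Poly_Mapping.lookup \<alpha> i}"
proof (rule bij_betwI[where g = "\<lambda>b. (Abs_poly_mapping b, \<alpha> - Abs_poly_mapping b)"])
  have fin: "finite {i. b i \<noteq> 0}" if "\<forall>i. b i \<le> Poly_Mapping.lookup \<alpha> i" for b
    by (rule finite_support_le[OF _ that[rule_format]]) simp
  have inv: "Poly_Mapping.lookup (Abs_poly_mapping b) = b" if "\<forall>i. b i \<le> Poly_Mapping.lookup \<alpha> i" for b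
    using fin[OF that] by (simp add: Abs_poly_mapping_inverse)
  show "(\<lambda>p. Poly_Mapping.lookup (fst p)) \<in> splits \<alpha> \<rightarrow> {b. \<forall>i. b i \<le> Poly_Mapping.lookup \<alpha> i}"
    by (auto simp: splits_def lookup_add)
  show "(\<lambda>b. (Abs_poly_mapping b, \<alpha> - Abs_poly_mapping b)) \<in> {b. \<forall>i. b i \<le> Poly_Mapping.lookup \<alpha> i} \<rightarrow> splits \<alpha>"
    by (auto simp: splits_def inv lookup_add lookup_minus intro!: poly_mapping_eqI)
  show "(Abs_poly_mapping (Poly_Mapping.lookup (fst p)), \<alpha> - Abs_poly_mapping (Poly_Mapping.lookup (fst p))) = p"
    if "p \<in> splits \<alpha>" for p
    using that by (auto simp: splits_def)
  show "Poly_Mapping.lookup (fst (Abs_poly_mapping b, \<alpha> - Abs_poly_mapping b)) = b"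
    if "b \<in> {b. \<forall>i. b i \<le> Poly_Mapping.lookup \<alpha> i}" for b
    using that by (simp add: inv)
qed

lemma finite_splits [simp]: "finite (splits \<alpha>)"
  using bij_betw_finite[OF bij_betw_splits[of \<alpha>]] finite_le_finite_support[of "Poly_Mapping.lookup \<alpha>"] by simp

lemma splits_0 [simp]: "splits 0 = {(0, 0)}"
proof (intro equalityI subsetI)
  fix p assume "p \<in> splits 0"
  then have eq: "fst p + snd p = 0"
    by (auto simp: splits_def)
  have "Poly_Mapping.lookup (fst p) i + Poly_Mapping.lookup (snd p) i = 0" for i
    using arg_cong[OF eq, of "\<lambda>\<beta>. Poly_Mapping.lookup \<beta> i"] by (simp add: lookup_add)
  then have "fst p = 0" "snd p = 0"
    by (auto intro!: poly_mapping_eqI)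
  then show "p \<in> {(0, 0)}"
    by (simp add: prod_eq_iff)
qed (simp add: splits_def)

instantiation mfps :: (comm_ring_1) comm_ring_1
begin

lift_definition zero_mfps :: "'a mfps" is "\<lambda>_. 0" .
lift_definition one_mfps :: "'a mfps" is "\<lambda>\<beta>. if \<beta> = 0 then 1 else 0" .
lift_definition plus_mfps :: "'a mfps \<Rightarrow> 'a mfps \<Rightarrow> 'a mfps" is "\<lambda>f g \<beta>. f \<beta> + g \<beta>" .
lift_definition minus_mfps :: "'a mfps \<Rightarrow> 'a mfps \<Rightarrow> 'a mfps" is "\<lambda>f g \<beta>. f \<beta> - g \<beta>" .
lift_definition uminus_mfps :: "'a mfps \<Rightarrow> 'a mfps" is "\<lambda>f \<beta>. - f \<beta>" .
lift_definition times_mfps :: "'a mfps \<Rightarrow> 'a mfps \<Rightarrow> 'a mfps" is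
  "\<lambda>f g \<alpha>. \<Sum>(\<beta>, \<gamma>)\<in>splits \<alpha>. f \<beta> * g \<gamma>" .

instance
proof
  fix a b c :: "'a mfps"
  show "a + b + c = a + (b + c)" "a + b = b + a" "0 + a = a" "- a + a = 0" "a - b = a + - b"
    by (transfer; auto)+
  show "a * b * c = a * (b * c)"
  proof (rule mfps_eqI, transfer)
    fix a b c :: "(nat \<Rightarrow>\<^sub>0 nat) \<Rightarrow> 'a" and \<alpha>
    have "(\<Sum>(\<beta>, \<gamma>)\<in>splits \<alpha>. (\<Sum>(\<delta>, \<epsilon>)\<in>splits \<beta>. a \<delta> * b \<epsilon>) * c \<gamma>)
        = (\<Sum>p\<in>splits \<alpha>. \<Sum>q\<in>splits (fst p). a (fst q) * b (snd q) * c (snd p))"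
      by (simp add: sum_distrib_right case_prod_unfold)
    also have "\<dots> = (\<Sum>(p, q)\<in>(SIGMA p:splits \<alpha>. splits (fst p)). a (fst q) * b (snd q) * c (snd p))"
      by (subst sum.Sigma) auto
    \<comment> \<open>Both sides run over triples of exponents with sum \<alpha>; the witnesses only
      rebracket them.\<close>
    also have "\<dots> = (\<Sum>(p, q)\<in>(SIGMA p:splits \<alpha>. splits (snd p)). a (fst p) * (b (fst q) * c (snd q)))"
      by (rule sum.reindex_bij_witness[where
            i = "\<lambda>(p, q). ((fst p + fst q, snd q), (fst p, fst q))" and
            j = "\<lambda>(p, q). ((fst q, snd q + snd p), (snd q, snd p))"])
        (auto simp: splits_def algebra_simps)
    also have "\<dots> = (\<Sum>p\<in>splits \<alpha>. \<Sum>q\<in>splits (snd p). a (fst p) * (b (fst q) * c (snd q)))"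
      by (subst sum.Sigma) auto
    also have "\<dots> = (\<Sum>(\<beta>, \<gamma>)\<in>splits \<alpha>. a \<beta> * (\<Sum>(\<delta>, \<epsilon>)\<in>splits \<gamma>. b \<delta> * c \<epsilon>))"
      by (simp add: sum_distrib_left case_prod_unfold)
    finally show "(\<Sum>(\<beta>, \<gamma>)\<in>splits \<alpha>. (\<Sum>(\<delta>, \<epsilon>)\<in>splits \<beta>. a \<delta> * b \<epsilon>) * c \<gamma>)
        = (\<Sum>(\<beta>, \<gamma>)\<in>splits \<alpha>. a \<beta> * (\<Sum>(\<delta>, \<epsilon>)\<in>splits \<gamma>. b \<delta> * c \<epsilon>))" .
  qed
  show "a * b = b * a"
  proof (rule mfps_eqI, transfer)
    fix a b :: "(nat \<Rightarrow>\<^sub>0 nat) \<Rightarrow> 'a" and \<alpha>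
    show "(\<Sum>(\<beta>, \<gamma>)\<in>splits \<alpha>. a \<beta> * b \<gamma>) = (\<Sum>(\<beta>, \<gamma>)\<in>splits \<alpha>. b \<beta> * a \<gamma>)"
      by (rule sum.reindex_bij_witness[where i = prod.swap and j = prod.swap])
        (auto simp: splits_def algebra_simps)
  qed
  show "1 * a = a"
  proof (rule mfps_eqI, transfer)
    fix a :: "(nat \<Rightarrow>\<^sub>0 nat) \<Rightarrow> 'a" and \<alpha>
    have "(\<Sum>(\<beta>, \<gamma>)\<in>splits \<alpha>. (if \<beta> = 0 then 1 else 0) * a \<gamma>)
        = (\<Sum>p\<in>{(0 :: nat \<Rightarrow>\<^sub>0 nat, \<alpha>)}. a (snd p))"
      by (rule sum.mono_neutral_cong_right[OF finite_splits]) (auto simp: splits_def split: if_splits)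
    then show "(\<Sum>(\<beta>, \<gamma>)\<in>splits \<alpha>. (if \<beta> = 0 then 1 else 0) * a \<gamma>) = a \<alpha>"
      by simp
  qed
  show "(a + b) * c = a * c + b * c"
    by (rule mfps_eqI, transfer) (simp add: case_prod_unfold distrib_right sum.distrib)
  show "(0 :: 'a mfps) \<noteq> 1"
    by transfer (metis zero_neq_one)
qed

end

lift_definition mfps_C :: "'a::zero \<Rightarrow> 'a mfps" is "\<lambda>a \<beta>. if \<beta> = 0 then a else 0" .
lift_definition mfps_X :: "nat \<Rightarrow> 'a::{zero,one} mfps" is
  "\<lambda>i \<beta>. if \<beta> = Poly_Mapping.single i 1 then 1 else 0" .

text \<open>The constant term is the residue map, a ring homomorphism to the coefficients.
  Nonvanishing of residues is the open condition carried through the whole specialization.\<close>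

abbreviation mfps_res :: "'a mfps \<Rightarrow> 'a" where
  "mfps_res f \<equiv> mfps_coeff f 0"

lemma mfps_coeff_C_mult [simp]: "mfps_coeff (mfps_C a * f) \<alpha> = a * mfps_coeff f \<alpha>"
proof transfer
  fix a :: 'a and f :: "(nat \<Rightarrow>\<^sub>0 nat) \<Rightarrow> 'a" and \<alpha>
  have "(\<Sum>(\<beta>, \<gamma>)\<in>splits \<alpha>. (if \<beta> = 0 then a else 0) * f \<gamma>)
      = (\<Sum>p\<in>{(0 :: nat \<Rightarrow>\<^sub>0 nat, \<alpha>)}. a * f (snd p))"
    by (rule sum.mono_neutral_cong_right[OF finite_splits]) (auto simp: splits_def split: if_splits)
  then show "(\<Sum>(\<beta>, \<gamma>)\<in>splits \<alpha>. (if \<beta> = 0 then a else 0) * f \<gamma>) = a * f \<alpha>"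
    by simp
qed

lemma mfps_coeff_simps [simp]:
  "mfps_coeff 0 \<beta> = 0"
  "mfps_coeff (f + g) \<beta> = mfps_coeff f \<beta> + mfps_coeff g \<beta>"
  "mfps_coeff (f - g) \<beta> = mfps_coeff f \<beta> - mfps_coeff g \<beta>"
  "mfps_coeff (- f) \<beta> = - mfps_coeff f \<beta>"
  by (simp_all add: zero_mfps.rep_eq plus_mfps.rep_eq minus_mfps.rep_eq uminus_mfps.rep_eq)

lemma mfps_res_X [simp]: "mfps_res (mfps_X i) = 0"
proof -
  have "Poly_Mapping.single i (1 :: nat) \<noteq> 0"
    by (metis lookup_single_eq lookup_zero zero_neq_one)
  then show ?thesis by (auto simp: mfps_X.rep_eq)
qed

lemma mfps_res_simps [simp]:
  "mfps_res (f * g) = mfps_res f * mfps_res g" "mfps_res 1 = 1" "mfps_res (mfps_C a) = a"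
  by (simp_all add: times_mfps.rep_eq one_mfps.rep_eq mfps_C.rep_eq)

lemma mfps_C_simps [simp]:
  "mfps_C (a + b) = mfps_C a + mfps_C b"
  "mfps_C (a * b) = mfps_C a * mfps_C b"
  "mfps_C 0 = 0" "mfps_C 1 = 1"
  by (rule mfps_eqI, simp add: mfps_C.rep_eq one_mfps.rep_eq)+

section \<open>The filtration of power series by order\<close>

definition mdeg :: "(nat \<Rightarrow>\<^sub>0 nat) \<Rightarrow> nat" where
  "mdeg \<beta> = (\<Sum>i\<in>Poly_Mapping.keys \<beta>. Poly_Mapping.lookup \<beta> i)"

lemma mdeg_add: "mdeg (\<beta> + \<gamma>) = mdeg \<beta> + mdeg \<gamma>"
  unfolding mdeg_def using setsum_keys_plus_distrib[where f = "\<lambda>_ x. x" and p = \<beta> and q = \<gamma>] by simp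

lemma mdeg_eq_0: "mdeg \<beta> = 0 \<longleftrightarrow> \<beta> = 0"
  by (auto simp: mdeg_def in_keys_iff intro!: poly_mapping_eqI)

text \<open>Series of order at least \<open>k\<close>, in the role of the \<open>k\<close>-th power
  of the maximal ideal; convergence of the Newton iteration is measured by it.\<close>

definition mfps_ideal :: "nat \<Rightarrow> 'a::zero mfps set" where
  "mfps_ideal k = {f. \<forall>\<beta>. mdeg \<beta> < k \<longrightarrow> mfps_coeff f \<beta> = 0}"

lemma mfps_ideal_add: "f \<in> mfps_ideal k \<Longrightarrow> g \<in> mfps_ideal k \<Longrightarrow> f + g \<in> mfps_ideal k"
  by (auto simp: mfps_ideal_def)

lemma mfps_ideal_0 [simp]: "f \<in> mfps_ideal 0"
  by (simp add: mfps_ideal_def)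

lemma mfps_ideal_1: "f \<in> mfps_ideal (Suc 0) \<longleftrightarrow> mfps_res f = 0"
  by (simp add: mfps_ideal_def mdeg_eq_0)

lemma mfps_ideal_mono: "f \<in> mfps_ideal k \<Longrightarrow> j \<le> k \<Longrightarrow> f \<in> mfps_ideal j"
  by (auto simp: mfps_ideal_def)

lemma mfps_ideal_mult:
  assumes "f \<in> mfps_ideal j" "g \<in> mfps_ideal k"
  shows "f * g \<in> mfps_ideal (j + k)"
proof -
  have "mfps_coeff f \<beta> * mfps_coeff g \<gamma> = 0" if "mdeg \<beta> + mdeg \<gamma> < j + k" for \<beta> \<gamma>
  proof (cases "mdeg \<beta> < j")
    case False
    then have "mdeg \<gamma> < k" using that by linarith
    then show ?thesis using assms by (simp add: mfps_ideal_def)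
  qed (use assms in \<open>simp add: mfps_ideal_def\<close>)
  then show ?thesis
    by (auto simp: mfps_ideal_def times_mfps.rep_eq splits_def mdeg_add intro!: sum.neutral)
qed

lemma mfps_ideal_mult_left: "g \<in> mfps_ideal k \<Longrightarrow> f * g \<in> mfps_ideal k"
  using mfps_ideal_mult[of f 0 g k] by simp

section \<open>Hensel's lemma\<close>

lemma poly_diff_factor:
  fixes f :: "'a::comm_ring_1 poly"
  shows "\<exists>w. poly f t - poly f u = (t - u) * w"
proof (induction f)
  case (pCons a f)
  then obtain w where w: "poly f t - poly f u = (t - u) * w" by blast
  have "poly (pCons a f) t - poly (pCons a f) u = (t - u) * poly f t + u * (poly f t - poly f u)"
    by (simp add: algebra_simps)
  also have "\<dots> = (t - u) * (poly f t + u * w)"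
    by (simp add: w algebra_simps)
  finally show ?case by blast
qed (intro exI[of _ 0], simp)

lemma mfps_res_poly: "mfps_res (poly (f::'a::comm_ring_1 mfps poly) t) = poly (map_poly mfps_res f) (mfps_res t)"
  by (induction f) (simp_all add: map_poly_pCons)

text \<open>Second-order Taylor expansion. Of the linear coefficient \<open>d\<close> only the
  residue is identified, as a derivative of the reduced polynomial, so no derivative over power
  series has to be formed.\<close>

lemma mfps_poly_taylor:
  fixes f :: "'a::field mfps poly"
  shows "\<exists>d w. mfps_res d = poly (pderiv (map_poly mfps_res f)) (mfps_res t) \<and>
    poly f (t + s) = poly f t + s * d + s ^ 2 * w"
proof (induction f)
  case (pCons a f)
  then obtain d w where d: "mfps_res d = poly (pderiv (map_poly mfps_res f)) (mfps_res t)"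
    and w: "poly f (t + s) = poly f t + s * d + s ^ 2 * w" by blast
  have "poly (pCons a f) (t + s) = poly (pCons a f) t + s * (poly f t + t * d)
      + s ^ 2 * (d + (t + s) * w)"
    unfolding poly_pCons w by (simp add: algebra_simps power2_eq_square)
  moreover have "mfps_res (poly f t + t * d) =
      poly (pderiv (map_poly mfps_res (pCons a f))) (mfps_res t)"
    by (simp add: d map_poly_pCons pderiv_pCons mfps_res_poly)
  ultimately show ?case by blast
qed (intro exI[of _ 0], simp)

text \<open>Newton iteration from the residue root raises the order of \<open>poly f (T k)\<close>
  by at least one per step, and each coefficient of \<open>T k\<close> is eventually constant, so
  the limit is a root.\<close>

lemma hensel_mfps:
  fixes f :: "'a::field mfps poly"
  assumes root: "poly (map_poly mfps_res f) a = 0"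
    and simple: "poly (pderiv (map_poly mfps_res f)) a \<noteq> 0"
  obtains t where "poly f t = 0" "mfps_res t = a"
proof -
  define d where "d = poly (pderiv (map_poly mfps_res f)) a"
  \<comment> \<open>The slope is fixed to the residue derivative \<open>d\<close> instead of the
    derivative at the current approximant. One order per step suffices, and no power series is
    inverted; inverses are themselves obtained from this lemma.\<close>
  define T where "T = rec_nat (mfps_C a) (\<lambda>_ t. t - mfps_C (1 / d) * poly f t)"
  have T_0: "T 0 = mfps_C a" and T_Suc: "T (Suc k) = T k - mfps_C (1 / d) * poly f (T k)" for k
    by (simp_all add: T_def)
  have step: "mfps_res (T k) = a \<and> poly f (T k) \<in> mfps_ideal (Suc k)" for k
  proof (induction k)
    case 0
    then show ?case by (simp add: T_0 mfps_ideal_1 mfps_res_poly root)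
  next
    case (Suc k)
    define e where "e = poly f (T k)"
    define s where "s = - mfps_C (1 / d) * e"
    have res: "mfps_res (T k) = a" and e: "e \<in> mfps_ideal (Suc k)"
      using Suc by (simp_all add: e_def)
    have s: "s \<in> mfps_ideal (Suc k)"
      unfolding s_def by (rule mfps_ideal_mult_left[OF e])
    have s1: "s \<in> mfps_ideal (Suc 0)"
      by (rule mfps_ideal_mono[OF s]) simp
    have T: "T (Suc k) = T k + s"
      by (simp add: T_Suc s_def e_def)
    obtain D w where D: "mfps_res D = d"
      and "poly f (T k + s) = e + s * D + s ^ 2 * w"
      using mfps_poly_taylor[of f "T k" s] unfolding e_def res d_def by blast
    note this(2)
    also have "\<dots> = e * (1 - mfps_C (1 / d) * D) + (w * s) * s"
      by (simp add: s_def power2_eq_square algebra_simps)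
    finally have eq: "poly f (T (Suc k)) =
      e * (1 - mfps_C (1 / d) * D) + (w * s) * s"
      by (simp add: T)
    \<comment> \<open>The error \<open>e\<close> gains an order from this factor, whose residue is
      \<open>1 - d / d = 0\<close>; the quadratic term gains one because \<open>s\<close> has order
      at least \<open>Suc k\<close> and a further factor \<open>s\<close>.\<close>
    have "1 - mfps_C (1 / d) * D \<in> mfps_ideal (Suc 0)"
      using simple by (simp add: mfps_ideal_1 D d_def)
    then have "e * (1 - mfps_C (1 / d) * D) \<in> mfps_ideal (Suc k + Suc 0)"
      by (rule mfps_ideal_mult[OF e])
    moreover have "(w * s) * s \<in> mfps_ideal (Suc 0 + Suc k)"
      by (rule mfps_ideal_mult[OF mfps_ideal_mult_left[OF s1] s])
    ultimately have "poly f (T (Suc k)) \<in> mfps_ideal (Suc (Suc k))"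
      unfolding eq by (intro mfps_ideal_add) simp_all
    moreover have "mfps_res (T (Suc k)) = a"
      using s1 by (simp add: T res mfps_ideal_1)
    ultimately show ?case by simp
  qed
  \<comment> \<open>The correction from \<open>T k\<close> to \<open>T (Suc k)\<close> has order at
    least \<open>Suc k\<close>, so the coefficient at \<beta> is final from step
    \<open>mdeg \<beta>\<close> on and can be read there.\<close>
  define t where "t = Abs_mfps (\<lambda>\<beta>. mfps_coeff (T (mdeg \<beta>)) \<beta>)"
  have coeff_t: "mfps_coeff t \<beta> = mfps_coeff (T (mdeg \<beta>)) \<beta>" for \<beta>
    by (simp add: t_def Abs_mfps_inverse)
  have "mfps_coeff (T (mdeg \<beta> + k)) \<beta> = mfps_coeff (T (mdeg \<beta>)) \<beta>" for \<beta> k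
  proof (induction k)
    case (Suc k)
    have "mfps_C (1 / d) * poly f (T (mdeg \<beta> + k)) \<in> mfps_ideal (Suc (mdeg \<beta> + k))"
      using step by (intro mfps_ideal_mult_left) blast
    then have "mfps_coeff (mfps_C (1 / d) * poly f (T (mdeg \<beta> + k))) \<beta> = 0"
      unfolding mfps_ideal_def by auto
    then show ?case using Suc by (simp add: T_Suc)
  qed simp
  note T_stable = this
  have "t - T k \<in> mfps_ideal (Suc k)" for k
  proof -
    have "mfps_coeff (T (mdeg \<beta>)) \<beta> = mfps_coeff (T k) \<beta>" if "mdeg \<beta> < Suc k" for \<beta>
      using T_stable[of \<beta> "k - mdeg \<beta>"] that by simp
    then show ?thesis by (simp add: mfps_ideal_def coeff_t)
  qed
  note T_approx = this
  have "poly f t \<in> mfps_ideal (Suc k)" for k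
  proof -
    obtain w where "poly f t - poly f (T k) = (t - T k) * w"
      using poly_diff_factor by blast
    then have "poly f t = w * (t - T k) + poly f (T k)"
      by (simp add: algebra_simps)
    then show ?thesis
      using mfps_ideal_add[OF mfps_ideal_mult_left[OF T_approx[of k]]] step[of k] by auto
  qed
  then have "poly f t = 0"
    by (intro mfps_eqI) (auto simp: mfps_ideal_def)
  moreover have "mfps_res t = a"
    using coeff_t[of 0] by (simp add: mdeg_def T_0)
  ultimately show thesis by (rule that)
qed

text \<open>The inverse is the Hensel lift of the simple root \<open>1 / mfps_res u\<close> of the
  linear polynomial \<open>u * X - 1\<close>.\<close>

lemma mfps_unit:
  fixes u :: "'a::field mfps"
  assumes "mfps_res u \<noteq> 0"
  obtains v where "v * u = 1"
proof -
  have "poly (map_poly mfps_res [:-1, u:]) (1 / mfps_res u) = 0"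
    "poly (pderiv (map_poly mfps_res [:-1, u:])) (1 / mfps_res u) \<noteq> 0"
    using assms by (auto simp: map_poly_pCons pderiv_pCons)
  then obtain v where "poly [:-1, u:] v = 0"
    by (rule hensel_mfps)
  then show thesis by (intro that[of v]) (simp add: algebra_simps)
qed

section \<open>Extending homomorphisms to adjoined elements\<close>

text \<open>The rings to be extended grow one generator at a time, so they are sets inside one
  ambient ring instead of types.\<close>

definition is_subring :: "'b::comm_ring_1 set \<Rightarrow> bool" where
  "is_subring B \<longleftrightarrow> 0 \<in> B \<and> 1 \<in> B \<and> (\<forall>x\<in>B. - x \<in> B) \<and> (\<forall>x\<in>B. \<forall>y\<in>B. x + y \<in> B \<and> x * y \<in> B)"

definition polys_over :: "'b::zero set \<Rightarrow> 'b poly set" where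
  "polys_over B = {g. \<forall>i. coeff g i \<in> B}"

text \<open>A homomorphism is a total function tested only on \<open>B\<close>; extending it means
  finding another function that agrees with it on \<open>B\<close>.\<close>

definition hom_on :: "'b::comm_ring_1 set \<Rightarrow> ('b \<Rightarrow> 'c::comm_ring_1) \<Rightarrow> bool" where
  "hom_on B \<phi> \<longleftrightarrow> \<phi> 0 = 0 \<and> \<phi> 1 = 1 \<and>
    (\<forall>x\<in>B. \<forall>y\<in>B. \<phi> (x + y) = \<phi> x + \<phi> y \<and> \<phi> (x * y) = \<phi> x * \<phi> y)"

definition adjoin :: "'b::comm_ring_1 set \<Rightarrow> 'b \<Rightarrow> 'b set" where
  "adjoin B y = (\<lambda>g. poly g y) ` polys_over B"

context
  fixes B :: "'b::comm_ring_1 set"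
  assumes B: "is_subring B"
begin

lemma subring_closed:
  "0 \<in> B" "1 \<in> B" "x \<in> B \<Longrightarrow> - x \<in> B" "x \<in> B \<Longrightarrow> y \<in> B \<Longrightarrow> x + y \<in> B"
  "x \<in> B \<Longrightarrow> y \<in> B \<Longrightarrow> x * y \<in> B"
  using B by (auto simp: is_subring_def)

lemma subring_power: "x \<in> B \<Longrightarrow> x ^ k \<in> B"
  by (induction k) (auto simp: subring_closed)

lemma subring_of_nat: "of_nat k \<in> B"
  by (induction k) (auto simp: subring_closed)

lemma subring_sum: "(\<And>i. i \<in> I \<Longrightarrow> f i \<in> B) \<Longrightarrow> sum f I \<in> B"
  by (induction I rule: infinite_finite_induct) (auto simp: subring_closed)

lemma polys_over_closed:
  "0 \<in> polys_over B" "1 \<in> polys_over B"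
  "c \<in> B \<Longrightarrow> [:c:] \<in> polys_over B"
  "f \<in> polys_over B \<Longrightarrow> - f \<in> polys_over B"
  "f \<in> polys_over B \<Longrightarrow> g \<in> polys_over B \<Longrightarrow> f + g \<in> polys_over B"
  "f \<in> polys_over B \<Longrightarrow> g \<in> polys_over B \<Longrightarrow> f - g \<in> polys_over B"
  "f \<in> polys_over B \<Longrightarrow> g \<in> polys_over B \<Longrightarrow> f * g \<in> polys_over B"
  "c \<in> B \<Longrightarrow> f \<in> polys_over B \<Longrightarrow> smult c f \<in> polys_over B"
  "c \<in> B \<Longrightarrow> monom c k \<in> polys_over B"
  using subring_closed
  by (auto simp: polys_over_def coeff_mult coeff_pCons split: nat.split intro!: subring_sum)
    (metis add_uminus_conv_diff)

lemma polys_over_X: "[:0, 1:] \<in> polys_over B"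
  using subring_closed by (auto simp: polys_over_def coeff_pCons split: nat.split)

lemma adjoinI: "g \<in> polys_over B \<Longrightarrow> poly g y \<in> adjoin B y"
  by (simp add: adjoin_def)

lemma is_subring_adjoin: "is_subring (adjoin B y)"
proof -
  have "- w \<in> adjoin B y" if w: "w \<in> adjoin B y" for w
  proof -
    obtain g where "g \<in> polys_over B" "w = poly g y"
      using w by (auto simp: adjoin_def)
    then show ?thesis
      using adjoinI[OF polys_over_closed(4), of g] by simp
  qed
  moreover have "w + x \<in> adjoin B y \<and> w * x \<in> adjoin B y"
    if w: "w \<in> adjoin B y" and x: "x \<in> adjoin B y" for w x
  proof -
    obtain g h where "g \<in> polys_over B" "h \<in> polys_over B" "w = poly g y" "x = poly h y"
      using w x by (auto simp: adjoin_def)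
    then show ?thesis
      using adjoinI[OF polys_over_closed(5), of g h] adjoinI[OF polys_over_closed(7), of g h] by simp
  qed
  ultimately show ?thesis
    using adjoinI[OF polys_over_closed(1)] adjoinI[OF polys_over_closed(2)]
    by (simp add: is_subring_def)
qed

lemma subset_adjoin: "b \<in> B \<Longrightarrow> b \<in> adjoin B y"
  using adjoinI[OF polys_over_closed(3)] by simp

lemma in_adjoin: "y \<in> adjoin B y"
  using adjoinI[OF polys_over_X] by simp

context
  fixes \<phi> :: "'b \<Rightarrow> 'c::comm_ring_1"
  assumes hom: "hom_on B \<phi>"
begin

lemma hom_on_simps:
  "\<phi> 0 = 0" "\<phi> 1 = 1"
  "x \<in> B \<Longrightarrow> y \<in> B \<Longrightarrow> \<phi> (x + y) = \<phi> x + \<phi> y"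
  "x \<in> B \<Longrightarrow> y \<in> B \<Longrightarrow> \<phi> (x * y) = \<phi> x * \<phi> y"
  using hom by (auto simp: hom_on_def)

lemma hom_on_uminus: "x \<in> B \<Longrightarrow> \<phi> (- x) = - \<phi> x"
  using hom_on_simps(3)[of "- x" x] subring_closed(3)[of x] hom_on_simps(1)
  by (simp add: eq_neg_iff_add_eq_0)

lemma hom_on_power: "x \<in> B \<Longrightarrow> \<phi> (x ^ k) = \<phi> x ^ k"
  by (induction k) (simp_all add: hom_on_simps subring_power)

lemma hom_on_of_nat: "\<phi> (of_nat k) = of_nat k"
  by (induction k) (simp_all add: hom_on_simps subring_of_nat subring_closed)

lemma hom_on_sum: "(\<And>i. i \<in> I \<Longrightarrow> f i \<in> B) \<Longrightarrow> \<phi> (sum f I) = (\<Sum>i\<in>I. \<phi> (f i))"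
  by (induction I rule: infinite_finite_induct) (simp_all add: hom_on_simps subring_sum)

lemma map_poly_hom_on:
  assumes "f \<in> polys_over B" "g \<in> polys_over B"
  shows "map_poly \<phi> (f + g) = map_poly \<phi> f + map_poly \<phi> g"
    and "map_poly \<phi> (f * g) = map_poly \<phi> f * map_poly \<phi> g"
    and "map_poly \<phi> (- f) = - map_poly \<phi> f"
proof -
  have in_B: "coeff f i \<in> B" "coeff g i \<in> B" for i
    using assms by (auto simp: polys_over_def)
  show "map_poly \<phi> (f + g) = map_poly \<phi> f + map_poly \<phi> g"
    by (rule poly_eqI) (simp add: coeff_map_poly hom_on_simps in_B)
  show "map_poly \<phi> (- f) = - map_poly \<phi> f"
    by (rule poly_eqI) (simp add: coeff_map_poly hom_on_simps hom_on_uminus in_B)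
  show "map_poly \<phi> (f * g) = map_poly \<phi> f * map_poly \<phi> g"
    by (rule poly_eqI)
      (simp add: coeff_map_poly coeff_mult hom_on_simps hom_on_sum in_B subring_closed)
qed

lemma map_poly_hom_on_smult:
  assumes "c \<in> B" "f \<in> polys_over B"
  shows "map_poly \<phi> (smult c f) = smult (\<phi> c) (map_poly \<phi> f)"
  using assms by (intro poly_eqI) (auto simp: coeff_map_poly hom_on_simps polys_over_def)

text \<open>The value at \<open>poly g y\<close> should be the image of \<open>g\<close> evaluated
  at \<open>t\<close>. Two representatives differ by a relation of \<open>y\<close>, and
  \<open>t\<close> satisfies the images of all these relations, so the choice of representative does
  not matter.\<close>

lemma hom_on_extend:
  assumes rel: "\<And>g. g \<in> polys_over B \<Longrightarrow> poly g y = 0 \<Longrightarrow> poly (map_poly \<phi> g) t = 0"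
  obtains \<psi> where "hom_on (adjoin B y) \<psi>"
    "\<And>g. g \<in> polys_over B \<Longrightarrow> \<psi> (poly g y) = poly (map_poly \<phi> g) t"
    "\<And>b. b \<in> B \<Longrightarrow> \<psi> b = \<phi> b" "\<psi> y = t"
proof -
  define rep where "rep w = (SOME g. g \<in> polys_over B \<and> poly g y = w)" for w
  define \<psi> where "\<psi> w = poly (map_poly \<phi> (rep w)) t" for w
  have \<psi>: "\<psi> (poly g y) = poly (map_poly \<phi> g) t" if g: "g \<in> polys_over B" for g
  proof -
    have rep: "rep (poly g y) \<in> polys_over B \<and> poly (rep (poly g y)) y = poly g y"
      unfolding rep_def by (rule someI[of _ g]) (simp add: g)
    define h where "h = rep (poly g y)"
    have h: "h \<in> polys_over B" "poly h y = poly g y"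
      using rep by (simp_all add: h_def)
    have "poly (map_poly \<phi> (h + - g)) t = 0"
      by (rule rel) (use h g polys_over_closed in simp_all)
    also have "map_poly \<phi> (h + - g) = map_poly \<phi> h - map_poly \<phi> g"
      using h(1) g polys_over_closed(4)[OF g] by (simp only: map_poly_hom_on) simp
    finally show ?thesis
      by (simp add: \<psi>_def flip: h_def)
  qed
  show thesis
  proof (rule that[of \<psi>])
    show "\<psi> b = \<phi> b" if "b \<in> B" for b
      using \<psi>[of "[:b:]"] that polys_over_closed(3)
      by (simp add: map_poly_pCons hom_on_simps)
    show "\<psi> y = t"
      using \<psi>[OF polys_over_X] by (simp add: map_poly_pCons hom_on_simps)
    have "\<psi> (w + x) = \<psi> w + \<psi> x \<and> \<psi> (w * x) = \<psi> w * \<psi> x"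
      if w: "w \<in> adjoin B y" and x: "x \<in> adjoin B y" for w x
    proof -
      obtain g h where gh: "g \<in> polys_over B" "h \<in> polys_over B" "w = poly g y" "x = poly h y"
        using w x by (auto simp: adjoin_def)
      then have "\<psi> (poly (g + h) y) = poly (map_poly \<phi> (g + h)) t"
        "\<psi> (poly (g * h) y) = poly (map_poly \<phi> (g * h)) t"
        by (intro \<psi> polys_over_closed; simp)+
      then show ?thesis
        using gh \<psi> by (simp add: map_poly_hom_on)
    qed
    then show "hom_on (adjoin B y) \<psi>"
      using \<psi>[OF polys_over_closed(1)] \<psi>[OF polys_over_closed(2)]
      by (simp add: hom_on_def map_poly_1 hom_on_simps)
  qed (use \<psi> in blast)
qed

end

end

section \<open>Derivatives, pseudo-division and minimal polynomials over a subring\<close>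

lemma pderiv_polys_over:
  fixes f :: "'b::idom poly"
  assumes "is_subring B" "f \<in> polys_over B"
  shows "pderiv f \<in> polys_over B"
  using assms subring_closed(5)[OF assms(1) subring_of_nat[OF assms(1)]]
  by (auto simp: polys_over_def coeff_pderiv simp del: of_nat_Suc)

lemma map_poly_pderiv_hom_on:
  fixes f :: "'b::idom poly" and \<phi> :: "'b \<Rightarrow> 'c::idom"
  assumes "is_subring B" "hom_on B \<phi>" "f \<in> polys_over B"
  shows "map_poly \<phi> (pderiv f) = pderiv (map_poly \<phi> f)"
  using assms subring_of_nat[OF assms(1)] hom_on_of_nat[OF assms(1,2)]
  by (intro poly_eqI)
    (simp add: coeff_map_poly coeff_pderiv hom_on_simps[OF assms(1,2)] polys_over_def del: of_nat_Suc)

lemma pseudo_division_over: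
  fixes h :: "'b::idom poly"
  assumes B: "is_subring B" and h: "h \<in> polys_over B" "h \<noteq> 0" and "g \<in> polys_over B"
  shows "\<exists>q\<in>polys_over B. \<exists>r\<in>polys_over B. \<exists>e.
    smult (lead_coeff h ^ e) g = h * q + r \<and> (r = 0 \<or> degree r < degree h)"
  using assms(4)
proof (induction "degree g" arbitrary: g rule: less_induct)
  case less
  note cl = polys_over_closed[OF B] subring_closed[OF B]
  show ?case
  proof (cases "g = 0 \<or> degree g < degree h")
    case True
    have "smult (lead_coeff h ^ 0) g = h * 0 + g" by simp
    then show ?thesis using True less.prems cl(1) by blast
  next
    case False
    then have deg: "degree h \<le> degree g" and "g \<noteq> 0" by auto
    \<comment> \<open>Multiplying \<open>g\<close> by the leading coefficient of \<open>h\<close>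
      allows its leading term to be cancelled without dividing in \<open>B\<close>.\<close>
    define m where "m = monom (lead_coeff g) (degree g - degree h)"
    define g' where "g' = smult (lead_coeff h) g - h * m"
    have lc: "lead_coeff h \<in> B" "lead_coeff g \<in> B"
      using h less.prems by (auto simp: polys_over_def)
    have m: "m \<in> polys_over B" and g': "g' \<in> polys_over B"
      unfolding m_def g'_def using lc less.prems h by (auto intro!: cl)
    have m_nz: "m \<noteq> 0"
      using \<open>g \<noteq> 0\<close> by (simp add: m_def)
    have deg_hm: "degree (h * m) = degree g"
      using h(2) m_nz deg \<open>g \<noteq> 0\<close> by (simp add: degree_mult_eq m_def degree_monom_eq)
    have "degree g' \<le> degree g"
      unfolding g'_def using deg_hm by (intro degree_diff_le) auto
    moreover have "coeff g' (degree g) = 0"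
    proof -
      have "coeff (h * m) (degree g) = lead_coeff h * lead_coeff m"
        using lead_coeff_mult[of h m] deg_hm by simp
      also have "lead_coeff m = lead_coeff g"
        by (simp add: m_def degree_monom_eq \<open>g \<noteq> 0\<close>)
      finally show ?thesis by (simp add: g'_def)
    qed
    \<comment> \<open>If \<open>g\<close> and \<open>h\<close> are both constant, the cancellation
      leaves \<open>0\<close>, whose degree has not dropped; hence the separate case.\<close>
    ultimately have "g' = 0 \<or> degree g' < degree g"
      by (metis le_neq_implies_less leading_coeff_0_iff)
    then have "\<exists>q\<in>polys_over B. \<exists>r\<in>polys_over B. \<exists>e.
        smult (lead_coeff h ^ e) g' = h * q + r \<and> (r = 0 \<or> degree r < degree h)"
    proof
      assume "g' = 0"
      then have "smult (lead_coeff h ^ 0) g' = h * 0 + 0" by simp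
      then show ?thesis using cl(1) by blast
    qed (use less.hyps g' in blast)
    then obtain q r e where qr: "q \<in> polys_over B" "r \<in> polys_over B"
      "smult (lead_coeff h ^ e) g' = h * q + r" "r = 0 \<or> degree r < degree h"
      by blast
    have "smult (lead_coeff h ^ Suc e) g = smult (lead_coeff h ^ e) (g' + h * m)"
      by (simp add: g'_def mult.commute)
    also have "\<dots> = h * (q + smult (lead_coeff h ^ e) m) + r"
      by (simp add: smult_add_right qr(3) algebra_simps)
    finally have "smult (lead_coeff h ^ Suc e) g = h * (q + smult (lead_coeff h ^ e) m) + r" .
    moreover have "q + smult (lead_coeff h ^ e) m \<in> polys_over B"
      using qr m lc subring_power[OF B] by (intro cl)
    ultimately show ?thesis using qr by blast
  qed
qed

text \<open>Pseudo-division stands in for division over the fraction field of the subring.\<close>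

locale min_poly_over =
  fixes B :: "'b::idom set" and y :: 'b and f :: "'b poly"
  assumes B: "is_subring B"
    and f: "f \<in> polys_over B" "f \<noteq> 0" "poly f y = 0"
    and minimal: "\<And>g. g \<in> polys_over B \<Longrightarrow> g \<noteq> 0 \<Longrightarrow> poly g y = 0 \<Longrightarrow> degree f \<le> degree g"
begin

text \<open>The pseudo-remainder of \<open>g\<close> by \<open>f\<close> vanishes at
  \<open>y\<close> and has smaller degree than \<open>f\<close>, so it is zero. Hence, up to powers
  of the leading coefficient, \<open>f\<close> generates all relations of \<open>y\<close>.\<close>

lemma relation_dvd:
  assumes "g \<in> polys_over B" "poly g y = 0"
  obtains q e where "q \<in> polys_over B" "smult (lead_coeff f ^ e) g = f * q"
proof -
  obtain q r e where qr: "q \<in> polys_over B" "r \<in> polys_over B"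
    "smult (lead_coeff f ^ e) g = f * q + r" "r = 0 \<or> degree r < degree f"
    using pseudo_division_over[OF B f(1,2) assms(1)] by blast
  have "poly r y = 0"
    using arg_cong[OF qr(3), of "\<lambda>p. poly p y"] assms f by simp
  then have "r = 0"
    using qr minimal[of r] by fastforce
  then show thesis using that qr by simp
qed

text \<open>Over the fraction field \<open>f\<close> is irreducible and does not divide
  \<open>g\<close>; clearing denominators in a Bezout identity gives \<delta>. Directly: a nonzero
  \<open>h\<close> of least degree in the ideal \<open>J\<close> of \<open>f\<close> and
  \<open>g\<close> pseudo-divides both. As \<open>h\<close> does not vanish at \<open>y\<close>, its
  cofactor in \<open>f\<close> does, so by minimality that cofactor has at least the degree of
  \<open>f\<close> and \<open>h\<close> is constant.\<close>

lemma bezout: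
  assumes g: "g \<in> polys_over B" "poly g y \<noteq> 0"
  obtains u v \<delta> where "u \<in> polys_over B" "v \<in> polys_over B" "\<delta> \<in> B" "\<delta> \<noteq> 0"
    "u * f + v * g = [:\<delta>:]"
proof -
  note cl = polys_over_closed[OF B]
  define J where "J = {u * f + v * g | u v. u \<in> polys_over B \<and> v \<in> polys_over B}"
  have J_over: "h \<in> polys_over B" if "h \<in> J" for h
    using that f g by (auto simp: J_def intro!: cl)
  have J_f: "f \<in> J" and J_g: "g \<in> J"
    unfolding J_def using cl(1,2) by force+
  have J_closed: "smult c a - h * q \<in> J"
    if "c \<in> B" "a \<in> J" "h \<in> J" "q \<in> polys_over B" for c a h q
  proof -
    obtain u v where uv: "a = u * f + v * g" "u \<in> polys_over B" "v \<in> polys_over B"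
      using \<open>a \<in> J\<close> by (auto simp: J_def)
    obtain u' v' where uv': "h = u' * f + v' * g" "u' \<in> polys_over B" "v' \<in> polys_over B"
      using \<open>h \<in> J\<close> by (auto simp: J_def)
    have "smult c a - h * q = (smult c u - u' * q) * f + (smult c v - v' * q) * g"
      by (simp add: uv uv' smult_add_right algebra_simps)
    moreover have "smult c u - u' * q \<in> polys_over B" "smult c v - v' * q \<in> polys_over B"
      using that uv uv' by (auto intro!: cl)
    ultimately show ?thesis unfolding J_def by blast
  qed
  obtain h where h: "h \<in> J" "h \<noteq> 0"
    and h_min: "\<And>k. k \<in> J \<Longrightarrow> k \<noteq> 0 \<Longrightarrow> degree h \<le> degree k"
    using ex_has_least_nat[of "\<lambda>h. h \<in> J \<and> h \<noteq> 0" f degree] J_f f(2) by blast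
  have h_dvd: "\<exists>q\<in>polys_over B. \<exists>e. smult (lead_coeff h ^ e) a = h * q" if a: "a \<in> J" for a
  proof -
    obtain q r e where qr: "q \<in> polys_over B" "smult (lead_coeff h ^ e) a = h * q + r"
      "r = 0 \<or> degree r < degree h"
      using pseudo_division_over[OF B J_over[OF h(1)] h(2) J_over[OF a]] by blast
    have "lead_coeff h ^ e \<in> B"
      using J_over[OF h(1)] by (intro subring_power[OF B]) (simp add: polys_over_def)
    \<comment> \<open>The remainder is a combination of members of \<open>J\<close>, hence in
      \<open>J\<close>, and the least degree of \<open>h\<close> forces it to be zero.\<close>
    then have "r \<in> J"
      using J_closed[OF _ a h(1) qr(1)] qr(2) by (metis add_diff_cancel_left')
    then have "r = 0"
      using qr(3) h_min[of r] by fastforce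
    then show ?thesis using qr by auto
  qed
  obtain q e where q: "q \<in> polys_over B" "smult (lead_coeff h ^ e) f = h * q"
    using h_dvd[OF J_f] by blast
  obtain q' e' where "smult (lead_coeff h ^ e') g = h * q'"
    using h_dvd[OF J_g] by blast
  from arg_cong[OF this, of "\<lambda>p. poly p y"] have "poly h y \<noteq> 0"
    using g(2) h(2) by auto
  moreover have "poly h y * poly q y = 0"
    using arg_cong[OF q(2), of "\<lambda>p. poly p y"] f(3) by simp
  ultimately have "poly q y = 0" by simp
  moreover have "q \<noteq> 0"
    using q(2) f(2) h(2) by auto
  ultimately have "degree f \<le> degree q"
    using minimal q(1) by blast
  moreover have "degree f = degree h + degree q"
    using arg_cong[OF q(2), of degree] h(2) \<open>q \<noteq> 0\<close> by (simp add: degree_mult_eq)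
  ultimately have "degree h = 0" by simp
  then obtain \<delta> where \<delta>: "h = [:\<delta>:]" by (rule degree_eq_zeroE)
  moreover have "\<delta> \<in> B"
    using J_over[OF h(1)] unfolding \<delta> polys_over_def by (auto dest: spec[of _ 0])
  ultimately show thesis
    using that h unfolding J_def by auto
qed

end

section \<open>Adjoining one generator to a homomorphism into power series\<close>

lemma mfps_res_poly_map:
  assumes "\<phi> 0 = 0"
  shows "mfps_res (poly (map_poly \<phi> g) t) = poly (map_poly (\<lambda>x. mfps_res (\<phi> x)) g) (mfps_res t)"
  using assms by (simp add: mfps_res_poly map_poly_map_poly o_def)

lemma hom_on_mfps_res: "hom_on B \<phi> \<Longrightarrow> hom_on B (\<lambda>x. mfps_res (\<phi> x))"
  by (simp add: hom_on_def)

text \<open>Without relations every image of \<open>y\<close> is allowed. Take \<open>b\<close> to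
  be the leading coefficient of the polynomial representing \<open>w\<close>: if its residue
  survives, the reduced polynomial is nonzero, and the constant \<open>c\<close> only has to avoid
  its finitely many roots. The shift \<open>s\<close> leaves residues unchanged and makes room for a
  variable.\<close>

lemma extend_transcendental:
  fixes B :: "'b::idom set" and s :: "'a::field_char_0 mfps"
  assumes B: "is_subring B"
    and y: "\<And>g. g \<in> polys_over B \<Longrightarrow> poly g y = 0 \<Longrightarrow> g = 0"
    and w: "w \<in> adjoin B y" "w \<noteq> 0"
    and s: "mfps_res s = 0"
  shows "\<exists>b\<in>B. b \<noteq> 0 \<and> (\<forall>\<phi>. hom_on B \<phi> \<and> mfps_res (\<phi> b) \<noteq> 0 \<longrightarrow>
    (\<exists>\<psi> c. hom_on (adjoin B y) \<psi> \<and> (\<forall>x\<in>B. \<psi> x = \<phi> x) \<and> \<psi> y = mfps_C c + s \<and> mfps_res (\<psi> w) \<noteq> 0))"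
proof -
  obtain h where h: "h \<in> polys_over B" "w = poly h y"
    using w by (auto simp: adjoin_def)
  have "h \<noteq> 0" using h w by auto
  show ?thesis
  proof (intro bexI[of _ "lead_coeff h"] conjI allI impI, goal_cases)
    case (2 \<phi>)
    then have hom: "hom_on B \<phi>" and nz: "mfps_res (\<phi> (lead_coeff h)) \<noteq> 0" by auto
    have \<phi>0: "\<phi> 0 = 0" using hom by (simp add: hom_on_def)
    define k where "k = map_poly (\<lambda>x. mfps_res (\<phi> x)) h"
    have "coeff k (degree h) \<noteq> 0"
      using nz by (simp add: k_def coeff_map_poly \<phi>0)
    then have "k \<noteq> 0" by auto
    then have "finite {c. poly k c = 0}" by (rule poly_roots_finite)
    then obtain c where c: "poly k c \<noteq> 0"
      using ex_new_if_finite[OF infinite_UNIV_char_0] by blast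
    obtain \<psi> where \<psi>: "hom_on (adjoin B y) \<psi>"
      "\<And>g. g \<in> polys_over B \<Longrightarrow> \<psi> (poly g y) = poly (map_poly \<phi> g) (mfps_C c + s)"
      "\<And>b. b \<in> B \<Longrightarrow> \<psi> b = \<phi> b" "\<psi> y = mfps_C c + s"
      by (rule hom_on_extend[OF B hom, of y "mfps_C c + s"]) (use y in force)+
    have "mfps_res (\<psi> w) = poly k c"
      using s by (simp add: h \<psi>(2) mfps_res_poly_map \<phi>0 k_def)
    then show ?case using \<psi> c by auto
  qed (use \<open>h \<noteq> 0\<close> h in \<open>auto simp: polys_over_def\<close>)
qed

text \<open>The image of \<open>y\<close> is a Hensel lift of a root of the reduced minimal
  polynomial. The element \<open>b\<close> has one factor per requirement: the leading coefficient
  keeps the degree and becomes a unit, \<open>\<delta>\<^sub>1\<close> keeps the root simple, and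
  \<open>\<delta>\<^sub>2\<close> keeps the image of \<open>w\<close> nonzero at the root.\<close>

lemma extend_algebraic:
  fixes B :: "'b::{idom,ring_char_0} set"
  assumes B: "is_subring B"
    and y: "p \<in> polys_over B" "poly p y = 0" "p \<noteq> 0"
    and w: "w \<in> adjoin B y" "w \<noteq> 0"
  shows "\<exists>b\<in>B. b \<noteq> 0 \<and> (\<forall>\<phi>::'b \<Rightarrow> 'a::{alg_closed_field,field_char_0} mfps. hom_on B \<phi> \<and> mfps_res (\<phi> b) \<noteq> 0 \<longrightarrow>
    (\<exists>\<psi>. hom_on (adjoin B y) \<psi> \<and> (\<forall>x\<in>B. \<psi> x = \<phi> x) \<and> mfps_res (\<psi> w) \<noteq> 0))"
proof -
  obtain f where f: "f \<in> polys_over B" "f \<noteq> 0" "poly f y = 0"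
    and f_min: "\<And>g. g \<in> polys_over B \<and> g \<noteq> 0 \<and> poly g y = 0 \<Longrightarrow> degree f \<le> degree g"
    using ex_has_least_nat[of "\<lambda>g. g \<in> polys_over B \<and> g \<noteq> 0 \<and> poly g y = 0" p degree] y by blast
  interpret min_poly_over B y f
    by unfold_locales (use B f f_min in auto)
  obtain h where h: "h \<in> polys_over B" "w = poly h y"
    using w(1) by (auto simp: adjoin_def)
  have deg_f: "degree f > 0"
    using f(2,3) by (auto intro!: Nat.gr0I elim: degree_eq_zeroE)
  have "pderiv f \<noteq> 0" "degree (pderiv f) < degree f"
    using deg_f by (auto simp: pderiv_eq_0_iff degree_pderiv)
  \<comment> \<open>In characteristic zero the derivative is nonzero, and its degree is too small
    for a relation of \<open>y\<close>.\<close>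
  then have f': "poly (pderiv f) y \<noteq> 0"
    using minimal[of "pderiv f"] pderiv_polys_over[OF B f(1)] by fastforce
  obtain u\<^sub>1 v\<^sub>1 \<delta>\<^sub>1 where bez1: "u\<^sub>1 \<in> polys_over B" "v\<^sub>1 \<in> polys_over B" "\<delta>\<^sub>1 \<in> B" "\<delta>\<^sub>1 \<noteq> 0"
    "u\<^sub>1 * f + v\<^sub>1 * pderiv f = [:\<delta>\<^sub>1:]"
    using bezout[OF pderiv_polys_over[OF B f(1)] f'] by blast
  obtain u\<^sub>2 v\<^sub>2 \<delta>\<^sub>2 where bez2: "u\<^sub>2 \<in> polys_over B" "v\<^sub>2 \<in> polys_over B" "\<delta>\<^sub>2 \<in> B" "\<delta>\<^sub>2 \<noteq> 0"
    "u\<^sub>2 * f + v\<^sub>2 * h = [:\<delta>\<^sub>2:]"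
    using bezout[OF h(1)] w(2) h(2) by blast
  define b where "b = lead_coeff f * (\<delta>\<^sub>1 * \<delta>\<^sub>2)"
  have lc: "lead_coeff f \<in> B" using f by (simp add: polys_over_def)
  show ?thesis
  proof (intro bexI[of _ b] conjI allI impI, goal_cases)
    case (2 \<phi>)
    then have hom: "hom_on B \<phi>" and nz: "mfps_res (\<phi> b) \<noteq> 0" by auto
    note cl = subring_closed[OF B] polys_over_closed[OF B]
    have \<phi>0: "\<phi> 0 = 0" using hom by (simp add: hom_on_def)
    have "\<phi> b = \<phi> (lead_coeff f) * (\<phi> \<delta>\<^sub>1 * \<phi> \<delta>\<^sub>2)"
      unfolding b_def using bez1 bez2 lc by (simp add: hom_on_simps[OF B hom] cl)
    with nz have nz: "mfps_res (\<phi> (lead_coeff f)) \<noteq> 0" "mfps_res (\<phi> \<delta>\<^sub>1) \<noteq> 0" "mfps_res (\<phi> \<delta>\<^sub>2) \<noteq> 0"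
      by auto
    define \<rho> where "\<rho> x = mfps_res (\<phi> x)" for x
    have \<rho>: "hom_on B \<rho>"
      unfolding \<rho>_def by (rule hom_on_mfps_res[OF hom])
    have \<rho>0: "\<rho> 0 = 0" by (simp add: \<rho>_def \<phi>0)
    have "coeff (map_poly \<rho> f) (degree f) \<noteq> 0"
      using nz by (simp add: coeff_map_poly \<rho>0) (simp add: \<rho>_def)
    then have "degree (map_poly \<rho> f) \<ge> degree f" by (rule le_degree)
    then obtain a where a: "poly (map_poly \<rho> f) a = 0"
      using deg_f alg_closed_imp_poly_has_root[of "map_poly \<rho> f"] by auto
    have bez: "poly (map_poly \<rho> g) a \<noteq> 0"
      if "u * f + v * g = [:\<delta>:]" "u \<in> polys_over B" "v \<in> polys_over B" "g \<in> polys_over B" "\<rho> \<delta> \<noteq> 0"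
      for u v g \<delta>
    proof -
      \<comment> \<open>At the root \<open>a\<close> of the reduced \<open>f\<close>, the reduced
        Bezout identity leaves only the product of \<open>v\<close> and \<open>g\<close>, with
        nonzero value \<delta>.\<close>
      have "map_poly \<rho> (u * f + v * g) = map_poly \<rho> u * map_poly \<rho> f + map_poly \<rho> v * map_poly \<rho> g"
        using that(2-4) f(1) by (simp add: map_poly_hom_on[OF B \<rho>] cl)
      from arg_cong[OF this, of "\<lambda>p. poly p a"] show ?thesis
        using a that(5) by (auto simp: that(1) map_poly_pCons \<rho>0)
    qed
    have simple: "poly (pderiv (map_poly \<rho> f)) a \<noteq> 0"
      using bez[OF bez1(5,1,2)] nz pderiv_polys_over[OF B f(1)]
        map_poly_pderiv_hom_on[OF B \<rho> f(1)] by (simp add: \<rho>_def)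
    have h_nz: "poly (map_poly \<rho> h) a \<noteq> 0"
      using bez[OF bez2(5,1,2) h(1)] nz by (simp add: \<rho>_def)
    have \<rho>_poly: "map_poly mfps_res (map_poly \<phi> g) = map_poly \<rho> g" for g
      by (simp add: map_poly_map_poly o_def \<phi>0 \<rho>_def[abs_def])
    obtain t where t: "poly (map_poly \<phi> f) t = 0" "mfps_res t = a"
      using hensel_mfps[of "map_poly \<phi> f" a] a simple by (auto simp: \<rho>_poly)
    obtain lc_inv where lc_inv: "lc_inv * \<phi> (lead_coeff f) = 1"
      using nz by (rule_tac mfps_unit)
    \<comment> \<open>After multiplication by a power of the leading coefficient a relation is a
      multiple of \<open>f\<close>, so its image vanishes at \<open>t\<close> up to that power. The
      image of the leading coefficient is a unit and can be cancelled.\<close>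
    have rel: "poly (map_poly \<phi> g) t = 0" if g: "g \<in> polys_over B" "poly g y = 0" for g
    proof -
      obtain q e where q: "q \<in> polys_over B" "smult (lead_coeff f ^ e) g = f * q"
        using relation_dvd[OF g] by blast
      have "map_poly \<phi> (smult (lead_coeff f ^ e) g) = smult (\<phi> (lead_coeff f) ^ e) (map_poly \<phi> g)"
        using g lc by (simp add: map_poly_hom_on_smult[OF B hom] hom_on_power[OF B hom] subring_power[OF B])
      moreover have "map_poly \<phi> (f * q) = map_poly \<phi> f * map_poly \<phi> q"
        using f q by (simp add: map_poly_hom_on[OF B hom])
      ultimately have "\<phi> (lead_coeff f) ^ e * poly (map_poly \<phi> g) t = 0"
        using q(2) t by (metis mult_zero_left poly_mult poly_smult)
      then have "lc_inv ^ e * (\<phi> (lead_coeff f) ^ e * poly (map_poly \<phi> g) t) = 0"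
        by simp
      then have "(lc_inv * \<phi> (lead_coeff f)) ^ e * poly (map_poly \<phi> g) t = 0"
        by (simp add: power_mult_distrib mult.assoc)
      then show ?thesis by (simp add: lc_inv)
    qed
    obtain \<psi> where \<psi>: "hom_on (adjoin B y) \<psi>"
      "\<And>g. g \<in> polys_over B \<Longrightarrow> \<psi> (poly g y) = poly (map_poly \<phi> g) t"
      "\<And>b. b \<in> B \<Longrightarrow> \<psi> b = \<phi> b"
      using hom_on_extend[OF B hom rel] by metis
    have "mfps_res (\<psi> w) = poly (map_poly \<rho> h) a"
      by (simp add: h \<psi>(2) mfps_res_poly \<rho>_poly t)
    then show ?case using \<psi> h_nz by auto
  qed (use lc bez1 bez2 f subring_closed[OF B] in \<open>auto simp: b_def\<close>)
qed

section \<open>An ultrapower with generic coordinates\<close>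

definition is_ultrafilter :: "'x filter \<Rightarrow> bool" where
  "is_ultrafilter U \<longleftrightarrow> U \<noteq> bot \<and> (\<forall>P. eventually P U \<or> eventually (\<lambda>x. \<not> P x) U)"

text \<open>Zorn's lemma for the reversed order gives a minimal proper filter below
  \<open>F\<close>, that is, a finest one; minimality makes it an ultrafilter.\<close>

lemma ex_ultrafilter_le:
  assumes "F \<noteq> (bot :: 'x filter)"
  obtains U where "U \<le> F" "is_ultrafilter U"
proof -
  let ?A = "{G. G \<le> F \<and> G \<noteq> bot}"
  have "\<exists>m\<in>?A. \<forall>a\<in>?A. a \<le> m \<longrightarrow> a = m"
  proof (rule predicate_Zorn)
    show "partial_order_on ?A (relation_of (\<lambda>x y. y \<le> x) ?A)"
      by (rule partial_order_on_relation_ofI) auto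
    fix C assume C: "C \<in> Chains (relation_of (\<lambda>x y. y \<le> x) ?A)"
    show "\<exists>u\<in>?A. \<forall>a\<in>C. u \<le> a"
    proof (cases "C = {}")
      case False
      have sub: "C \<subseteq> ?A" and chain: "\<And>x y. x \<in> C \<Longrightarrow> y \<in> C \<Longrightarrow> x \<le> y \<or> y \<le> x"
        using C by (auto simp: Chains_def relation_of_def)
      \<comment> \<open>A nonempty chain is a base of its infimum, so an event of the infimum
        already belongs to one member. As every member is proper, so is the infimum.\<close>
      have "eventually P (Inf C) \<longleftrightarrow> (\<exists>b\<in>C. eventually P b)" for P
      proof (rule eventually_Inf_base[OF False])
        fix x y assume xy: "x \<in> C" "y \<in> C"
        from chain[OF xy] show "\<exists>z\<in>C. z \<le> inf x y"
        proof
          assume "x \<le> y" then show ?thesis using xy(1) by (intro bexI[of _ x]) simp_all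
        next
          assume "y \<le> x" then show ?thesis using xy(2) by (intro bexI[of _ y]) simp_all
        qed
      qed
      then have "Inf C \<noteq> bot"
        using sub by (auto simp: trivial_limit_def)
      moreover have "Inf C \<le> F"
      proof -
        obtain G where "G \<in> C" using False by blast
        then show ?thesis using sub Inf_lower2[of G C F] by blast
      qed
      ultimately show ?thesis
        by (intro bexI[of _ "Inf C"] ballI Inf_lower) simp_all
    qed (use assms in auto)
  qed
  then obtain U where U: "U \<le> F" "U \<noteq> bot" and min: "\<And>G. G \<le> F \<Longrightarrow> G \<noteq> bot \<Longrightarrow> G \<le> U \<Longrightarrow> G = U"
    by blast
  have "eventually P U" if "\<not> eventually (\<lambda>x. \<not> P x) U" for P
  proof -
    \<comment> \<open>Restricting \<open>U\<close> to \<open>P\<close> stays proper because the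
      complement is not an event; by minimality the restriction is \<open>U\<close> itself.\<close>
    have "inf U (principal {x. P x}) \<noteq> bot"
      using that by (auto simp: trivial_limit_def eventually_inf_principal)
    then have "inf U (principal {x. P x}) = U"
      using U(1) by (intro min) (simp_all add: le_infI1)
    then have "U \<le> principal {x. P x}"
      by (simp only: inf.absorb_iff1)
    then show ?thesis by (simp add: le_principal)
  qed
  then have "is_ultrafilter U"
    using U by (auto simp: is_ultrafilter_def)
  with U show thesis using that by blast
qed

section \<open>Polynomial functions and the generic ultrafilter\<close>

inductive polyfun :: "nat \<Rightarrow> ((nat \<Rightarrow> 'a::comm_ring_1) \<Rightarrow> 'a) \<Rightarrow> bool" for k where
  polyfun_const: "polyfun k (\<lambda>_. c)"
| polyfun_coord: "i < k \<Longrightarrow> polyfun k (\<lambda>x. x i)"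
| polyfun_add: "polyfun k f \<Longrightarrow> polyfun k g \<Longrightarrow> polyfun k (\<lambda>x. f x + g x)"
| polyfun_mult: "polyfun k f \<Longrightarrow> polyfun k g \<Longrightarrow> polyfun k (\<lambda>x. f x * g x)"

lemma polyfun_mono: "polyfun k f \<Longrightarrow> k \<le> l \<Longrightarrow> polyfun l f"
  by (induction rule: polyfun.induct) (auto intro: polyfun.intros)

lemma polyfun_cong: "polyfun k f \<Longrightarrow> (\<And>i. i < k \<Longrightarrow> x i = y i) \<Longrightarrow> f x = f y"
  by (induction rule: polyfun.induct) auto

lemma polyfun_power: "polyfun k f \<Longrightarrow> polyfun k (\<lambda>x. f x ^ n)"
  by (induction n) (auto intro: polyfun.intros)

lemma polyfun_sum: "(\<And>i. i \<in> I \<Longrightarrow> polyfun k (f i)) \<Longrightarrow> polyfun k (\<lambda>x. \<Sum>i\<in>I. f i x)"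
  by (induction I rule: infinite_finite_induct) (auto intro: polyfun.intros)

lemma polyfun_line:
  assumes "polyfun k f"
  shows "\<exists>p. \<forall>t. f (\<lambda>i. a i + t * (b i - a i)) = poly p t"
  using assms
proof (induction rule: polyfun.induct)
  case (polyfun_const c)
  show ?case by (intro exI[of _ "[:c:]"]) simp
next
  case (polyfun_coord i)
  show ?case by (intro exI[of _ "[:a i, b i - a i:]"]) simp
next
  case (polyfun_add f g)
  then show ?case by (metis poly_add)
next
  case (polyfun_mult f g)
  then show ?case by (metis poly_mult)
qed

text \<open>On the line joining \<open>a\<close> to \<open>b\<close> both functions become
  univariate polynomials, nonzero at parameters 0 and 1 respectively; their product has finitely
  many roots in an infinite field. This is the finite intersection property for nonvanishing
  sets.\<close>

lemma polyfun_common_nonzero: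
  fixes f g :: "(nat \<Rightarrow> 'a::field_char_0) \<Rightarrow> 'a"
  assumes "polyfun k f" "polyfun l g" "f a \<noteq> 0" "g b \<noteq> 0"
  shows "\<exists>x. f x * g x \<noteq> 0"
proof -
  obtain p where p: "\<And>t. f (\<lambda>i. a i + t * (b i - a i)) = poly p t"
    using polyfun_line[OF assms(1)] by blast
  obtain q where q: "\<And>t. g (\<lambda>i. a i + t * (b i - a i)) = poly q t"
    using polyfun_line[OF assms(2)] by blast
  have "p \<noteq> 0" "q \<noteq> 0"
    using assms(3,4) p[of 0] q[of 1] by auto
  then have "finite {t. poly (p * q) t = 0}"
    by (intro poly_roots_finite) simp
  then obtain t where "poly (p * q) t \<noteq> 0"
    using ex_new_if_finite[OF infinite_UNIV_char_0] by blast
  then show ?thesis using p q by (metis poly_mult)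
qed

text \<open>A fixed choice, so that a type can be built from it. Points have infinitely many
  coordinates, so one ultrafilter serves every number of variables.\<close>

definition generic_ultrafilter :: "(nat \<Rightarrow> 'a::field_char_0) filter" where
  "generic_ultrafilter = (SOME U. is_ultrafilter U \<and>
    (\<forall>k f. polyfun k f \<and> (\<exists>x. f x \<noteq> 0) \<longrightarrow> eventually (\<lambda>x. f x \<noteq> 0) U))"

text \<open>The nonvanishing set of a product lies in both nonvanishing sets, so these sets form a
  base of a proper filter; any ultrafilter refining it qualifies.\<close>

lemma generic_ultrafilter:
  fixes f :: "(nat \<Rightarrow> 'a::field_char_0) \<Rightarrow> 'a"
  shows "is_ultrafilter (generic_ultrafilter :: (nat \<Rightarrow> 'a) filter)"
  and "polyfun k f \<Longrightarrow> f x \<noteq> 0 \<Longrightarrow> eventually (\<lambda>x. f x \<noteq> 0) generic_ultrafilter"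
proof -
  define \<F> :: "(nat \<Rightarrow> 'a) filter set" where
    "\<F> = {principal {x. f x \<noteq> 0} | f. (\<exists>k. polyfun k f) \<and> (\<exists>x. f x \<noteq> 0)}"
  have \<F>: "principal {x. f x \<noteq> 0} \<in> \<F>" if "polyfun k f" "f x \<noteq> 0" for k f x
    using that unfolding \<F>_def by blast
  have "eventually P (Inf \<F>) \<longleftrightarrow> (\<exists>G\<in>\<F>. eventually P G)" for P
  proof (rule eventually_Inf_base)
    show "\<F> \<noteq> {}"
      using \<F>[OF polyfun_const[of 0 1] one_neq_zero] by blast
    fix G H assume "G \<in> \<F>" "H \<in> \<F>"
    then obtain f g k l a b where fg: "G = principal {x. f x \<noteq> 0}" "H = principal {x. g x \<noteq> 0}"
      "polyfun k f" "polyfun l g" "f a \<noteq> 0" "g b \<noteq> 0"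
      unfolding \<F>_def by blast
    obtain x where "f x * g x \<noteq> 0"
      using polyfun_common_nonzero fg(3-6) by blast
    moreover have "polyfun (max k l) (\<lambda>x. f x * g x)"
      using fg(3,4) by (intro polyfun_mult) (auto elim: polyfun_mono)
    ultimately have "principal {x. f x * g x \<noteq> 0} \<in> \<F>"
      by (rule \<F>[rotated])
    moreover have "principal {x. f x * g x \<noteq> 0} \<le> inf G H"
      by (auto simp: fg)
    ultimately show "\<exists>K\<in>\<F>. K \<le> inf G H" by blast
  qed
  note eventually_Inf_\<F> = this
  have "Inf \<F> \<noteq> bot"
  proof
    assume "Inf \<F> = bot"
    then obtain G where "G \<in> \<F>" "eventually (\<lambda>_. False) G"
      using eventually_Inf_\<F>[of "\<lambda>_. False"] by auto
    then show False
      unfolding \<F>_def by (auto simp: eventually_principal)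
  qed
  then obtain U where U: "U \<le> Inf \<F>" "is_ultrafilter U"
    by (rule ex_ultrafilter_le)
  have "eventually (\<lambda>x. f x \<noteq> 0) U" if "polyfun k f" "f x \<noteq> 0" for k f x
  proof -
    have "U \<le> principal {x. f x \<noteq> 0}"
      using U(1) Inf_lower[OF \<F>[OF that]] by (rule order.trans)
    then show ?thesis by (simp add: le_principal)
  qed
  with U(2) have "\<exists>U :: (nat \<Rightarrow> 'a) filter. is_ultrafilter U \<and>
    (\<forall>k f. polyfun k f \<and> (\<exists>x. f x \<noteq> 0) \<longrightarrow> eventually (\<lambda>x. f x \<noteq> 0) U)"
    by blast
  from someI_ex[OF this, folded generic_ultrafilter_def]
  show "is_ultrafilter (generic_ultrafilter :: (nat \<Rightarrow> 'a) filter)"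
    "polyfun k f \<Longrightarrow> f x \<noteq> 0 \<Longrightarrow> eventually (\<lambda>x. f x \<noteq> 0) generic_ultrafilter"
    by blast+
qed

\<comment> \<open>The ultrapower as an integral domain of characteristic zero\<close>
quotient_type (overloaded) 'a ultrapower = "(nat \<Rightarrow> 'a::field_char_0) \<Rightarrow> 'a" /
  "\<lambda>f g. eventually (\<lambda>x. f x = g x) generic_ultrafilter"
proof (rule equivpI)
  show "reflp (\<lambda>f g. eventually (\<lambda>x. f x = g x) (generic_ultrafilter :: (nat \<Rightarrow> 'a) filter))"
    by (auto simp: reflp_def)
  show "symp (\<lambda>f g. eventually (\<lambda>x. f x = g x) (generic_ultrafilter :: (nat \<Rightarrow> 'a) filter))"
    by (auto simp: symp_def eq_commute)
  show "transp (\<lambda>f g. eventually (\<lambda>x. f x = g x) (generic_ultrafilter :: (nat \<Rightarrow> 'a) filter))"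
    by (auto simp: transp_def elim: eventually_elim2)
qed

instantiation ultrapower :: (field_char_0) idom
begin

lift_definition zero_ultrapower :: "'a ultrapower" is "\<lambda>_. 0" .
lift_definition one_ultrapower :: "'a ultrapower" is "\<lambda>_. 1" .
lift_definition plus_ultrapower :: "'a ultrapower \<Rightarrow> 'a ultrapower \<Rightarrow> 'a ultrapower"
  is "\<lambda>f g x. f x + g x" by (erule (1) eventually_elim2) simp
lift_definition minus_ultrapower :: "'a ultrapower \<Rightarrow> 'a ultrapower \<Rightarrow> 'a ultrapower"
  is "\<lambda>f g x. f x - g x" by (erule (1) eventually_elim2) simp
lift_definition times_ultrapower :: "'a ultrapower \<Rightarrow> 'a ultrapower \<Rightarrow> 'a ultrapower"
  is "\<lambda>f g x. f x * g x" by (erule (1) eventually_elim2) simp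
lift_definition uminus_ultrapower :: "'a ultrapower \<Rightarrow> 'a ultrapower"
  is "\<lambda>f x. - f x" by (erule eventually_mono) simp

instance
proof
  have ultra: "generic_ultrafilter \<noteq> (bot :: (nat \<Rightarrow> 'a) filter)"
    "\<And>P. eventually P (generic_ultrafilter :: (nat \<Rightarrow> 'a) filter) \<or>
      eventually (\<lambda>x. \<not> P x) generic_ultrafilter"
    using generic_ultrafilter(1) unfolding is_ultrafilter_def by blast+
  fix a b c :: "'a ultrapower"
  show "a + b + c = a + (b + c)" "a + b = b + a" "0 + a = a" "- a + a = 0" "a - b = a + - b"
    "a * b * c = a * (b * c)" "a * b = b * a" "1 * a = a" "(a + b) * c = a * c + b * c"
    "a * (b + c) = a * b + a * c" "0 * a = 0" "a * 0 = 0"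
    by (transfer; simp add: algebra_simps)+
  show "(0 :: 'a ultrapower) \<noteq> 1"
    by transfer (simp add: ultra(1))
  \<comment> \<open>Here the ultrafilter property enters: a function that is not eventually zero is
    eventually nonzero, and two such events can be intersected.\<close>
  show "a \<noteq> 0 \<Longrightarrow> b \<noteq> 0 \<Longrightarrow> a * b \<noteq> 0"
  proof transfer
    fix a b :: "(nat \<Rightarrow> 'a) \<Rightarrow> 'a"
    assume "\<not> eventually (\<lambda>x. a x = 0) generic_ultrafilter" "\<not> eventually (\<lambda>x. b x = 0) generic_ultrafilter"
    then have "eventually (\<lambda>x. a x \<noteq> 0) generic_ultrafilter" "eventually (\<lambda>x. b x \<noteq> 0) generic_ultrafilter"
      using ultra(2) by blast+
    then have nz: "eventually (\<lambda>x. a x * b x \<noteq> 0) generic_ultrafilter"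
      by (rule eventually_elim2) simp
    show "\<not> eventually (\<lambda>x. a x * b x = 0) generic_ultrafilter"
    proof
      assume "eventually (\<lambda>x. a x * b x = 0) generic_ultrafilter"
      from eventually_conj[OF nz this]
      have "eventually (\<lambda>_. False) (generic_ultrafilter :: (nat \<Rightarrow> 'a) filter)"
        by (rule eventually_mono) auto
      then show False using ultra(1) by simp
    qed
  qed
qed

end

instance ultrapower :: (field_char_0) ring_char_0
proof
  show "inj (of_nat :: nat \<Rightarrow> 'a ultrapower)"
  proof (rule injI)
    fix m n :: nat
    have of_nat: "of_nat k = abs_ultrapower (\<lambda>_. of_nat k)" for k
      by (induction k) (simp_all add: zero_ultrapower_def one_ultrapower_def plus_ultrapower.abs_eq add.commute)
    assume "of_nat m = (of_nat n :: 'a ultrapower)"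
    then show "m = n" by (simp add: of_nat ultrapower.abs_eq_iff generic_ultrafilter(1)[unfolded is_ultrafilter_def])
  qed
qed

section \<open>Specialization of finitely generated extensions\<close>

primrec tower :: "'b::comm_ring_1 set \<Rightarrow> (nat \<Rightarrow> 'b) \<Rightarrow> nat \<Rightarrow> 'b set" where
  "tower B w 0 = B"
| "tower B w (Suc k) = adjoin (tower B w k) (w k)"

lemma is_subring_tower: "is_subring B \<Longrightarrow> is_subring (tower B w k)"
  by (induction k) (simp_all add: is_subring_adjoin)

lemma tower_mono: "is_subring B \<Longrightarrow> b \<in> tower B w k \<Longrightarrow> k \<le> l \<Longrightarrow> b \<in> tower B w l"
  by (rotate_tac 2, induction l rule: dec_induct) (simp_all add: subset_adjoin is_subring_tower)

lemma gen_in_tower: "is_subring B \<Longrightarrow> i < k \<Longrightarrow> w i \<in> tower B w k"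
  using tower_mono[of B "w i" w "Suc i" k] by (simp add: in_adjoin is_subring_tower Suc_le_eq)

lemma is_subring_range:
  assumes "hom_on UNIV \<iota>"
  shows "is_subring (range \<iota>)"
proof -
  have \<iota>_0: "\<iota> 0 = 0" and \<iota>_1: "\<iota> 1 = 1"
    and \<iota>_add: "\<iota> (x + y) = \<iota> x + \<iota> y" and \<iota>_mult: "\<iota> (x * y) = \<iota> x * \<iota> y" for x y
    using assms by (simp_all add: hom_on_def)
  have "\<iota> (- x) + \<iota> x = 0" for x
    using \<iota>_add[of "- x" x] by (simp add: \<iota>_0)
  then have \<iota>_uminus: "\<iota> (- x) = - \<iota> x" for x
    by (simp add: eq_neg_iff_add_eq_0)
  show ?thesis
    unfolding is_subring_def using rangeI[of \<iota> 0] rangeI[of \<iota> 1]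
    by (auto simp: \<iota>_0 \<iota>_1 simp flip: \<iota>_uminus \<iota>_add \<iota>_mult)
qed

text \<open>Induction on \<open>k\<close> with \<open>b\<close> arbitrary: a nonzero
  \<open>b\<close> in the top ring is traded for a nonzero \<open>b'\<close> one level below whose
  surviving residue guarantees an extension preserving \<open>b\<close>. By \<open>trans\<close> the
  first \<open>n\<close> generators fall under the transcendental case, which is what lets them go
  to a constant plus a variable.\<close>

lemma tower_specialization:
  fixes \<iota> :: "'a::{alg_closed_field,field_char_0} \<Rightarrow> 'b::{idom,ring_char_0}"
  assumes \<iota>: "inj \<iota>" "hom_on UNIV \<iota>"
    and trans: "\<And>i g. i < n \<Longrightarrow> g \<in> polys_over (tower (range \<iota>) w i) \<Longrightarrow> poly g (w i) = 0 \<Longrightarrow> g = 0"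
    and b: "b \<in> tower (range \<iota>) w k" "b \<noteq> 0"
  shows "\<exists>\<phi>. hom_on (tower (range \<iota>) w k) \<phi> \<and> (\<forall>a. \<phi> (\<iota> a) = mfps_C a) \<and>
    (\<forall>i<k. i < n \<longrightarrow> (\<exists>c. \<phi> (w i) = mfps_C c + mfps_X i)) \<and> mfps_res (\<phi> b) \<noteq> 0"
proof -
  have \<iota>_0: "\<iota> 0 = 0" and \<iota>_1: "\<iota> 1 = 1"
    and \<iota>_add: "\<iota> (x + y) = \<iota> x + \<iota> y" and \<iota>_mult: "\<iota> (x * y) = \<iota> x * \<iota> y" for x y
    using \<iota>(2) by (simp_all add: hom_on_def)
  have base: "is_subring (range \<iota>)"
    by (rule is_subring_range[OF \<iota>(2)])
  show ?thesis
    using b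
  proof (induction k arbitrary: b)
    case 0
    obtain a where a: "b = \<iota> a" using 0 by auto
    define \<phi> where "\<phi> x = mfps_C (inv \<iota> x)" for x
    have \<phi>: "\<phi> (\<iota> a) = mfps_C a" for a
      by (simp add: \<phi>_def inv_f_f[OF \<iota>(1)])
    have "hom_on (range \<iota>) \<phi>"
      unfolding hom_on_def using \<phi>[of 0] \<phi>[of 1]
      by (auto simp: \<phi> \<iota>_0 \<iota>_1 simp flip: \<iota>_add \<iota>_mult)
    moreover have "mfps_res (\<phi> b) \<noteq> 0"
      using 0(2) by (auto simp: a \<phi> \<iota>_0)
    ultimately show ?case using \<phi> by auto
  next
    case (Suc k)
    let ?B = "tower (range \<iota>) w k"
    have sub: "is_subring ?B" by (rule is_subring_tower[OF base])
    have \<iota>_in: "\<iota> a \<in> ?B" for a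
      using tower_mono[OF base, of "\<iota> a" w 0 k] by simp
    have gen_in: "w i \<in> ?B" if "i < k" for i
      using gen_in_tower[OF base that] .
    have b: "b \<in> adjoin ?B (w k)" "b \<noteq> 0" using Suc.prems by simp_all
    have "\<exists>b'\<in>?B. b' \<noteq> 0 \<and> (\<forall>\<phi>::'b \<Rightarrow> 'a mfps. hom_on ?B \<phi> \<and> mfps_res (\<phi> b') \<noteq> 0 \<longrightarrow>
      (\<exists>\<psi>. hom_on (adjoin ?B (w k)) \<psi> \<and> (\<forall>x\<in>?B. \<psi> x = \<phi> x) \<and>
        (k < n \<longrightarrow> (\<exists>c. \<psi> (w k) = mfps_C c + mfps_X k)) \<and> mfps_res (\<psi> b) \<noteq> 0))"
    proof (cases "\<forall>g\<in>polys_over ?B. poly g (w k) = 0 \<longrightarrow> g = 0")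
      case True
      \<comment> \<open>A transcendental generator of index at least \<open>n\<close> also receives
        its own variable. This does no harm: a coefficient of a product at an exponent in
        \<open>exps n\<close> involves only coefficients of the factors at exponents in
        \<open>exps n\<close>.\<close>
      then show ?thesis
        using extend_transcendental[OF sub _ b mfps_res_X[of k]] by blast
    next
      case False
      then obtain p where "p \<in> polys_over ?B" "poly p (w k) = 0" "p \<noteq> 0" by blast
      \<comment> \<open>The clause on \<open>k < n\<close> holds vacuously, since
        \<open>trans\<close> excludes an algebraic generator among the first
        \<open>n\<close>.\<close>
      from extend_algebraic[where 'a = 'a, OF sub this b] False show ?thesis
        using trans by blast
    qed
    then obtain b' where b': "b' \<in> ?B" "b' \<noteq> 0"
      and ext: "\<And>\<phi>::'b \<Rightarrow> 'a mfps. hom_on ?B \<phi> \<Longrightarrow> mfps_res (\<phi> b') \<noteq> 0 \<Longrightarrow>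
        \<exists>\<psi>. hom_on (adjoin ?B (w k)) \<psi> \<and> (\<forall>x\<in>?B. \<psi> x = \<phi> x) \<and>
          (k < n \<longrightarrow> (\<exists>c. \<psi> (w k) = mfps_C c + mfps_X k)) \<and> mfps_res (\<psi> b) \<noteq> 0"
      by blast
    obtain \<phi> where \<phi>: "hom_on ?B \<phi>" "\<And>a. \<phi> (\<iota> a) = mfps_C a"
      "\<And>i. i < k \<Longrightarrow> i < n \<Longrightarrow> \<exists>c. \<phi> (w i) = mfps_C c + mfps_X i" "mfps_res (\<phi> b') \<noteq> 0"
      using Suc.IH[OF b'] by blast
    obtain \<psi> where \<psi>: "hom_on (adjoin ?B (w k)) \<psi>" "\<And>x. x \<in> ?B \<Longrightarrow> \<psi> x = \<phi> x"
      "k < n \<Longrightarrow> \<exists>c. \<psi> (w k) = mfps_C c + mfps_X k" "mfps_res (\<psi> b) \<noteq> 0"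
      using ext[OF \<phi>(1,4)] by blast
    have "\<exists>c. \<psi> (w i) = mfps_C c + mfps_X i" if "i < Suc k" "i < n" for i
      using that \<psi>(2)[OF gen_in[of i]] \<psi>(3) \<phi>(3)[of i] by (cases "i = k") auto
    moreover have "\<psi> (\<iota> a) = mfps_C a" for a
      by (simp add: \<psi>(2)[OF \<iota>_in] \<phi>(2))
    ultimately show ?case
      using \<psi>(1,4) by (intro exI[of _ \<psi>]) simp
  qed
qed

section \<open>Comparison with coefficient functions\<close>

text \<open>Agreement is asked only at finitely supported exponents; these include all of
  \<open>exps n\<close>, where the final equality is read.\<close>

definition represents :: "'a mps \<Rightarrow> 'a mfps \<Rightarrow> bool" where
  "represents p F \<longleftrightarrow> (\<forall>\<gamma>. p (Poly_Mapping.lookup \<gamma>) = mfps_coeff F \<gamma>)"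

lemma represents_const: "represents (mps_const a) (mfps_C a)"
proof -
  have "Poly_Mapping.lookup \<gamma> = mps_zero_exp \<longleftrightarrow> \<gamma> = 0" for \<gamma> :: "nat \<Rightarrow>\<^sub>0 nat"
    by (auto simp: mps_zero_exp_def fun_eq_iff intro: poly_mapping_eqI)
  then show ?thesis by (simp add: represents_def mps_const_def mfps_C.rep_eq)
qed

lemma represents_one: "represents mps_one (1 :: 'a::comm_ring_1 mfps)"
  using represents_const[of "1 :: 'a"] by (simp add: mps_one_def)

lemma represents_var: "represents (mps_var i) (mfps_X i)"
proof -
  have "Poly_Mapping.lookup \<gamma> = (\<lambda>j. if j = i then 1 else 0) \<longleftrightarrow> \<gamma> = Poly_Mapping.single i 1"
    for \<gamma> :: "nat \<Rightarrow>\<^sub>0 nat"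
    by (auto simp: fun_eq_iff lookup_single when_def intro!: poly_mapping_eqI)
  then show ?thesis by (simp add: represents_def mps_var_def mfps_X.rep_eq)
qed

lemma represents_add: "represents p F \<Longrightarrow> represents q G \<Longrightarrow> represents (mps_add p q) (F + G)"
  by (simp add: represents_def mps_add_def)

lemma represents_mult:
  assumes "represents p F" "represents q G"
  shows "represents (mps_mult p q) (F * G)"
  unfolding represents_def
proof
  fix \<alpha> :: "nat \<Rightarrow>\<^sub>0 nat"
  have "mps_mult p q (Poly_Mapping.lookup \<alpha>) =
    (\<Sum>s\<in>splits \<alpha>. p (Poly_Mapping.lookup (fst s)) *
      q (\<lambda>i. Poly_Mapping.lookup \<alpha> i - Poly_Mapping.lookup (fst s) i))"
    unfolding mps_mult_def by (rule sum.reindex_bij_betw[OF bij_betw_splits, symmetric])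
  also have "\<dots> = (\<Sum>s\<in>splits \<alpha>. mfps_coeff F (fst s) * mfps_coeff G (snd s))"
  proof (rule sum.cong[OF refl])
    fix s assume "s \<in> splits \<alpha>"
    then have "(\<lambda>i. Poly_Mapping.lookup \<alpha> i - Poly_Mapping.lookup (fst s) i) = Poly_Mapping.lookup (snd s)"
      by (auto simp: splits_def lookup_add)
    then show "p (Poly_Mapping.lookup (fst s)) *
        q (\<lambda>i. Poly_Mapping.lookup \<alpha> i - Poly_Mapping.lookup (fst s) i)
      = mfps_coeff F (fst s) * mfps_coeff G (snd s)"
      using assms by (simp add: represents_def)
  qed
  finally show "mps_mult p q (Poly_Mapping.lookup \<alpha>) = mfps_coeff (F * G) \<alpha>"
    by (simp add: times_mfps.rep_eq case_prod_unfold)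
qed

lemma represents_pow: "represents p F \<Longrightarrow> represents (mps_pow p k) (F ^ k)"
  unfolding mps_pow_def by (induction k) (simp_all add: represents_one represents_mult)

lemma represents_monom:
  assumes "\<And>i. i < r \<Longrightarrow> represents (p i) (F i)"
  shows "represents (mps_monom r \<alpha> p) (\<Prod>i<r. F i ^ \<alpha> i)"
proof -
  have "represents (foldr (\<lambda>i acc. mps_mult (mps_pow (p i) (\<alpha> i)) acc) xs mps_one)
      (\<Prod>i\<leftarrow>xs. F i ^ \<alpha> i)" if "set xs \<subseteq> {..<r}" for xs
    using that
    by (induction xs) (auto intro!: represents_one represents_mult represents_pow assms)
  from this[of "[0..<r]"] show ?thesis
    using prod.distinct_set_conv_list[of "[0..<r]" "\<lambda>i. F i ^ \<alpha> i"]
    by (simp add: mps_monom_def atLeast0LessThan)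
qed

text \<open>The coefficient map \<kappa> is a parameter so that one expression covers evaluation in
  the ultrapower and in power series, and homomorphisms carry one to the other.\<close>

definition subst_poly ::
    "('a \<Rightarrow> 'c::comm_ring_1) \<Rightarrow> nat \<Rightarrow> ((nat \<Rightarrow> nat) \<Rightarrow> 'a::zero) \<Rightarrow> (nat \<Rightarrow> 'c) \<Rightarrow> 'c" where
  "subst_poly \<kappa> n P x = (\<Sum>\<alpha>\<in>{\<alpha>. P \<alpha> \<noteq> 0}. \<kappa> (P \<alpha>) * (\<Prod>i<n. x i ^ \<alpha> i))"

lemma mfps_coeff_sum: "mfps_coeff (sum f I) \<beta> = (\<Sum>i\<in>I. mfps_coeff (f i) \<beta>)"
  by (induction I rule: infinite_finite_induct) simp_all

lemma represents_peval:
  assumes "\<And>i. i < r \<Longrightarrow> represents (p i) (F i)"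
  shows "represents (mps_peval r P p) (subst_poly mfps_C r P F)"
  using represents_monom[of r p F, OF assms]
  by (simp add: represents_def mps_peval_def subst_poly_def mfps_coeff_sum)

lemma exps_lookup:
  assumes "\<beta> \<in> exps n"
  obtains \<gamma> where "\<beta> = Poly_Mapping.lookup \<gamma>"
proof -
  have "finite {i. \<beta> i \<noteq> 0}"
    by (rule finite_subset[of _ "{..<n}"]) (use assms in \<open>auto simp: exps_def intro: leI\<close>)
  then show thesis
    by (intro that[of "Abs_poly_mapping \<beta>"]) (simp add: Abs_poly_mapping_inverse)
qed

lemma hom_on_subst_poly:
  assumes "is_subring B" "hom_on B \<phi>" "\<And>a. \<kappa> a \<in> B" "\<And>i. i < n \<Longrightarrow> x i \<in> B"
  shows "\<phi> (subst_poly \<kappa> n P x) = subst_poly (\<lambda>a. \<phi> (\<kappa> a)) n P (\<lambda>i. \<phi> (x i))"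
proof -
  have prod: "(\<Prod>i\<in>I. x i ^ \<alpha> i) \<in> B \<and> \<phi> (\<Prod>i\<in>I. x i ^ \<alpha> i) = (\<Prod>i\<in>I. \<phi> (x i) ^ \<alpha> i)"
    if "I \<subseteq> {..<n}" for I and \<alpha> :: "nat \<Rightarrow> nat"
    using that assms(4)
    by (induction I rule: infinite_finite_induct)
      (auto simp: hom_on_simps[OF assms(1,2)] subring_closed[OF assms(1)]
        subring_power[OF assms(1)] hom_on_power[OF assms(1,2)])
  show ?thesis
    unfolding subst_poly_def using prod[OF order_refl] assms(3)
    by (simp add: hom_on_sum[OF assms(1,2)] hom_on_simps[OF assms(1,2)] subring_closed[OF assms(1)])
qed

section \<open>Generic coordinates are algebraically independent\<close>

definition up_const :: "'a::field_char_0 \<Rightarrow> 'a ultrapower" where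
  "up_const a = abs_ultrapower (\<lambda>_. a)"

lemma abs_ultrapower_sum:
  "abs_ultrapower (\<lambda>x. \<Sum>i\<in>I. f i x) = (\<Sum>i\<in>I. abs_ultrapower (f i))"
  by (induction I rule: infinite_finite_induct)
    (simp_all add: zero_ultrapower_def flip: plus_ultrapower.abs_eq)

lemma abs_ultrapower_prod:
  "abs_ultrapower (\<lambda>x. \<Prod>i\<in>I. f i x) = (\<Prod>i\<in>I. abs_ultrapower (f i))"
  by (induction I rule: infinite_finite_induct)
    (simp_all add: one_ultrapower_def flip: times_ultrapower.abs_eq)

lemma abs_ultrapower_power: "abs_ultrapower (\<lambda>x. f x ^ k) = abs_ultrapower f ^ k"
  by (induction k) (simp_all add: one_ultrapower_def flip: times_ultrapower.abs_eq)

text \<open>Ring operations on classes are pointwise, so an identity between polynomial values at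
  every point becomes an identity in the ultrapower.\<close>

lemma subst_poly_ultrapower:
  "subst_poly up_const n P (\<lambda>i. abs_ultrapower (f i)) = abs_ultrapower (\<lambda>x. peval n P (\<lambda>i. f i x))"
  by (simp add: subst_poly_def peval_def up_const_def abs_ultrapower_sum abs_ultrapower_prod
      abs_ultrapower_power flip: times_ultrapower.abs_eq)

lemma up_const_inj: "inj up_const"
proof (rule injI)
  fix a b :: 'a
  assume "up_const a = up_const b"
  then have "eventually (\<lambda>_. a = b) (generic_ultrafilter :: (nat \<Rightarrow> 'a) filter)"
    by (simp add: up_const_def ultrapower.abs_eq_iff)
  then show "a = b"
    using generic_ultrafilter(1) by (auto simp: is_ultrafilter_def eventually_const_iff)
qed

lemma up_const_hom: "hom_on UNIV up_const"
  by (simp add: hom_on_def up_const_def zero_ultrapower_def one_ultrapower_def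
      plus_ultrapower.abs_eq times_ultrapower.abs_eq)

text \<open>This is genericity: a polynomial function that is nonzero somewhere is nonzero on an
  event, so its class cannot be zero.\<close>

lemma polyfun_eq_zero:
  fixes f :: "(nat \<Rightarrow> 'a::field_char_0) \<Rightarrow> 'a"
  assumes "polyfun k f" "abs_ultrapower f = 0"
  shows "f x = 0"
proof (rule ccontr)
  assume "f x \<noteq> 0"
  with assms(1) have "eventually (\<lambda>x. f x \<noteq> 0) generic_ultrafilter"
    by (rule generic_ultrafilter(2))
  moreover have "eventually (\<lambda>x. f x = 0) generic_ultrafilter"
    using assms(2) by (simp add: zero_ultrapower_def ultrapower.abs_eq_iff)
  ultimately have "eventually (\<lambda>x. f x \<noteq> 0 \<and> f x = 0) generic_ultrafilter"
    by (rule eventually_conj)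
  then show False
    using generic_ultrafilter(1)[where 'a = 'a] by (simp add: is_ultrafilter_def)
qed

lemma tower_polyfun:
  assumes "\<And>i. i < k \<Longrightarrow> w i = abs_ultrapower (\<lambda>x. x i)" "b \<in> tower (range up_const) w k"
  shows "\<exists>f. polyfun k f \<and> b = abs_ultrapower f"
  using assms
proof (induction k arbitrary: b)
  case 0
  then show ?case by (auto simp: up_const_def intro: polyfun_const)
next
  case (Suc k)
  obtain g where g: "g \<in> polys_over (tower (range up_const) w k)" "b = poly g (w k)"
    using Suc.prems(2) by (auto simp: adjoin_def)
  have "\<forall>i. \<exists>f. polyfun k f \<and> coeff g i = abs_ultrapower f"
    using g Suc by (auto simp: polys_over_def)
  then obtain f where f: "\<And>i. polyfun k (f i)" "\<And>i. coeff g i = abs_ultrapower (f i)"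
    by metis
  have "b = abs_ultrapower (\<lambda>x. \<Sum>i\<le>degree g. f i x * x k ^ i)"
    by (simp add: g(2) poly_altdef f(2) Suc.prems(1) abs_ultrapower_sum
        flip: abs_ultrapower_power times_ultrapower.abs_eq)
  moreover have "polyfun (Suc k) (\<lambda>x. \<Sum>i\<le>degree g. f i x * x k ^ i)"
    by (intro polyfun_sum polyfun_mult polyfun_power polyfun_coord polyfun_mono[OF f(1)]) auto
  ultimately show ?case by blast
qed

text \<open>The coefficients of a relation are classes of polynomial functions in the first
  \<open>k\<close> coordinates, so the relation is a polynomial identity valid at every point.
  Moving coordinate \<open>k\<close> alone leaves the coefficients fixed, and a univariate
  polynomial vanishing everywhere over an infinite field is zero.\<close>

lemma coordinate_transcendental:
  fixes w :: "nat \<Rightarrow> 'a::field_char_0 ultrapower"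
  assumes w: "\<And>i. i \<le> k \<Longrightarrow> w i = abs_ultrapower (\<lambda>x. x i)"
    and g: "g \<in> polys_over (tower (range up_const) w k)" "poly g (w k) = 0"
  shows "g = 0"
proof -
  have "\<forall>i. \<exists>f. polyfun k f \<and> coeff g i = abs_ultrapower f"
    using g(1) by (auto simp: polys_over_def intro!: tower_polyfun[OF w])
  then obtain f where f: "\<And>i. polyfun k (f i)" "\<And>i. coeff g i = abs_ultrapower (f i)"
    by metis
  have "abs_ultrapower (\<lambda>x. \<Sum>i\<le>degree g. f i x * x k ^ i) = poly g (w k)"
    by (simp add: poly_altdef f(2) w abs_ultrapower_sum
        flip: abs_ultrapower_power times_ultrapower.abs_eq)
  moreover have "polyfun (Suc k) (\<lambda>x. \<Sum>i\<le>degree g. f i x * x k ^ i)"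
    by (intro polyfun_sum polyfun_mult polyfun_power polyfun_coord polyfun_mono[OF f(1)]) auto
  ultimately have zero: "(\<Sum>i\<le>degree g. f i x * x k ^ i) = 0" for x
    using g(2) by (intro polyfun_eq_zero) simp_all
  have "f i x = 0" if i: "i \<le> degree g" for i x
  proof -
    define p where "p = (\<Sum>i\<le>degree g. monom (f i x) i)"
    have "poly p t = 0" for t
    proof -
      have "f i (x(k := t)) = f i x" for i
        by (rule polyfun_cong[OF f(1)]) simp
      then show ?thesis
        using zero[of "x(k := t)"] by (simp add: p_def poly_sum poly_monom)
    qed
    then have "p = 0" using poly_all_0_iff_0 by blast
    then have "coeff p i = 0" by simp
    then show ?thesis using i by (simp add: p_def coeff_sum)
  qed
  then have "f (degree g) = (\<lambda>_. 0)" by auto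
  then have "coeff g (degree g) = 0"
    by (simp add: f(2) zero_ultrapower_def)
  then show ?thesis by simp
qed

section \<open>Specializing the generic solution to power series\<close>

theorem theorem1p14:
  fixes n m r :: nat
    and L :: "nat \<Rightarrow> (nat \<Rightarrow> nat) \<Rightarrow> 'a::{alg_closed_field, field_char_0}"
    and M :: "nat \<Rightarrow> (nat \<Rightarrow> nat) \<Rightarrow> 'a"
  assumes L_poly: "\<And>j. j < m \<Longrightarrow> is_mpoly n (L j)"
    and M_poly: "\<And>j. j < m \<Longrightarrow> is_mpoly r (M j)"
    and im_sub: "\<And>x. \<exists>y. \<forall>j<m. peval n (L j) x = peval r (M j) y"
  shows "\<exists>(c :: nat \<Rightarrow> 'a) (p :: nat \<Rightarrow> 'a mps).
           \<forall>j<m. \<forall>\<beta>\<in>exps n.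
             mps_peval n (L j) (\<lambda>i. mps_add (mps_var i) (mps_const (c i))) \<beta>
             = mps_peval r (M j) p \<beta>"
proof -
  \<comment> \<open>The preimages are chosen pointwise, with no regularity in \<open>x\<close>; the
    ultrapower contains the class of every function, so their components still define
    elements.\<close>
  obtain Y where Y: "\<And>x j. j < m \<Longrightarrow> peval n (L j) x = peval r (M j) (Y x)"
    using im_sub by metis
  define z where "z i = abs_ultrapower (\<lambda>x. x i :: 'a)" for i
  define y where "y i = abs_ultrapower (\<lambda>x. Y x i)" for i
  \<comment> \<open>Coordinates come first in the tower, so each is transcendental over its
    predecessors; the components of the preimage follow.\<close>
  define w where "w i = (if i < n then z i else y (i - n))" for i
  define T where "T = tower (range up_const) w (n + r)"
  have eq: "subst_poly up_const n (L j) z = subst_poly up_const r (M j) y" if "j < m" for j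
    using Y[OF that] by (simp add: z_def[abs_def] y_def[abs_def] subst_poly_ultrapower)
  have base: "is_subring (range (up_const :: 'a \<Rightarrow> _))"
    using is_subring_range[OF up_const_hom] .
  have T: "is_subring T"
    unfolding T_def by (rule is_subring_tower[OF base])
  have up_const_in: "up_const a \<in> T" for a
    unfolding T_def using tower_mono[OF base, of "up_const a" w 0 "n + r"] by simp
  have w_in: "w i \<in> T" if "i < n + r" for i
    unfolding T_def by (rule gen_in_tower[OF base that])
  \<comment> \<open>The induction keeps a prescribed nonzero element nonzero; here \<open>1\<close>
    is prescribed, as only the existence of \<phi> is wanted.\<close>
  have "\<exists>\<phi>. hom_on T \<phi> \<and> (\<forall>a. \<phi> (up_const a) = mfps_C a) \<and>
    (\<forall>i<n + r. i < n \<longrightarrow> (\<exists>c. \<phi> (w i) = mfps_C c + mfps_X i)) \<and> mfps_res (\<phi> 1) \<noteq> 0"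
    unfolding T_def
  proof (rule tower_specialization[OF up_const_inj up_const_hom])
    fix i g
    assume "i < n" "g \<in> polys_over (tower (range up_const) w i)" "poly g (w i) = 0"
    then show "g = 0"
      by (intro coordinate_transcendental[of i w g]) (simp_all add: w_def z_def)
  qed (use subring_closed(2)[OF T] in \<open>simp_all add: T_def\<close>)
  then obtain \<phi> where \<phi>: "hom_on T \<phi>" "\<And>a. \<phi> (up_const a) = mfps_C a"
    "\<And>i. i < n \<Longrightarrow> \<exists>c. \<phi> (w i) = mfps_C c + mfps_X i"
    by force
  then obtain c where c: "\<And>i. i < n \<Longrightarrow> \<phi> (z i) = mfps_C (c i) + mfps_X i"
    unfolding w_def by metis
  \<comment> \<open>\<open>Abs_poly_mapping\<close> is meaningful only at finitely supported
    exponents, which are the ones that \<open>represents\<close> looks at.\<close>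
  define p where "p i \<beta> = mfps_coeff (\<phi> (y i)) (Abs_poly_mapping \<beta>)" for i \<beta>
  have z_in: "z i \<in> T" if "i < n" for i
    using w_in[of i] that by (simp add: w_def)
  have y_in: "y i \<in> T" if "i < r" for i
    using w_in[of "n + i"] that by (simp add: w_def)
  have \<phi>_eq: "subst_poly mfps_C n (L j) (\<lambda>i. \<phi> (z i)) = subst_poly mfps_C r (M j) (\<lambda>i. \<phi> (y i))"
    if "j < m" for j
    \<comment> \<open>Applying \<phi> to the generic identity \<open>L(z) = M(y)\<close> gives the
      identity between power series.\<close>
    using arg_cong[OF eq[OF that], of \<phi>]
    by (simp add: hom_on_subst_poly[OF T \<phi>(1) up_const_in] z_in y_in \<phi>(2))
  have rep_L: "represents (mps_peval n (L j) (\<lambda>i. mps_add (mps_var i) (mps_const (c i))))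
    (subst_poly mfps_C n (L j) (\<lambda>i. \<phi> (z i)))" for j
    by (rule represents_peval)
      (simp add: c add.commute[of "mfps_C _"] represents_add represents_var represents_const)
  have rep_M: "represents (mps_peval r (M j) p) (subst_poly mfps_C r (M j) (\<lambda>i. \<phi> (y i)))" for j
    by (rule represents_peval) (simp add: represents_def p_def)
  have "mps_peval n (L j) (\<lambda>i. mps_add (mps_var i) (mps_const (c i))) \<beta> = mps_peval r (M j) p \<beta>"
    if j: "j < m" and \<beta>: "\<beta> \<in> exps n" for j \<beta>
  proof -
    obtain \<gamma> where "\<beta> = Poly_Mapping.lookup \<gamma>"
      using exps_lookup[OF \<beta>] .
    then show ?thesis
      using rep_L[of j] rep_M[of j] by (simp add: represents_def \<phi>_eq[OF j])
  qed
  then show ?thesis by blast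
qed

end
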